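(* There is a universal constant $C>0$ such that the following holds. Let $T\subset\ell^2$ be countable with $0\in T$ and $0<b(T)<\infty$, and let $(\mathcal A_m)_{m\ge0}$ with data $(I_m,\pi_m,j_m)$ be partitions of $T$ produced by the construction described in the context, with the constant $r$ fixed there. Then $$\sup_{t\in T}\sum_{n\ge0}2^n r^{-j_n(t)}\le C\,b(T).$$
   Context: Notation. $\mathbb N=\{1,2,\dots\}$, $\ell^2=\ell^2(\mathbb N)$, $N_n=2^{2^n}$ for $n\ge0$; $(\varepsilon_i)$ are independent random variables equal to $\pm1$ with probability $1/2$ each; $b(T)=\mathbb E\sup_{t\in T}\sum_{i}t_i\varepsilon_i$. Expectations of suprema are suprema of the corresponding expectations over nonempty finite subsets. For $r\ge2$, $j\in\mathbb Z$: $[x]_j=\max\{-3r^{-j},\min\{x,3r^{-j}\}\}$. For $I\subset\mathbb N$, $u\in\ell^2$, nonempty countable $D\subset\ell^2$: $\varphi_{I,u,j}(t)=([t_i-u_i]_j)_{i\in I}$, $F_{I,u,j}(D)=\mathbb E\sup_{t\in D}\sum_{i\in I}[t_i-u_i]_j\varepsilon_i$, $d_{I,u,j}(s,t)=\|\varphi_{I,u,j}(s)-\varphi_{I,u,j}(t)\|_2$. For a map $z:B\to\ell^2(\Lambda)$ and nonempty $D\subset B$: $b_z(D)=\mathbb E\sup_{t\in D}\sum_{i\in\Lambda}z_i(t)\varepsilon_i$. $B_d(w,\rho)=\{t:d(t,w)\le\rho\}$. "Universal" means independent of $T$ and of the partition indices. Constants (all universal). (1) $K\ge1$, $\eta_{\rm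 G}>0$ are such that for all real $r\ge2$, integers $q\ge1$, all $I,u,j$, every nonempty countable $A$ with $F_{I,u,j}(A)<\infty$ and $m=N_{q-1}$ (or $m=N_{q-2}$ when $q\ge2$) there exists a partition of $A$, called a greedy subdivision of $A$ at level $q$ with parameters $(I,u,j)$ and $m$, into sets $C_1,\dots,C_L$, $L\le m-1$, and a possibly empty remainder $R$, with centers $w_l\in C_l$ such that, with $d=d_{I,u,j}$, $C_l\subset B_d(w_l,2^{q/2}r^{-j})$, and, if $R\ne\varnothing$, $F_{I,u,j}(A)\ge F_{I,u,j}(D)+\eta_{\rm G}2^qr^{-j}$ for every $t\in R$ and nonempty $D\subset R\cap B_d(t,K^{-1}2^{q/2}r^{-j})$. (2) $c_*,C_*>0$ are such that: if $B$ is nonempty countable, $x:B\to\ell^2(\Lambda_1)$, $y:B\to\ell^2(\Lambda_2)$ with $\Lambda_1\cap\Lambda_2=\varnothing$, $z=(x,y)$, $d(s,t)=\|z(s)-z(t)\|_2$, $b_z(B)<\infty$, $\beta>0$, $\|z(s)-z(t)\|_\infty\le\beta$ and $\|y(s)-y(t)\|_2\le\delta$ for all $s,t\in B$, then for all $m\ge2$, $\rho>0$ there are $t^1,\dots,t^m\in B$ such that $R=B\setminus\bigcup_{p\le m}B_d(t^p,\rho)$ is empty or $b_y(R)\le b_z(B)-c_*\min\{\rho\sqrt{\log m},\rho^2/\beta\}+C_*\delta\sqrt{\log m}$. (3) $\ell$ is a sufficiently large positive integer, $r=2^{2\ell}$, $\kappa=3\ell$, with $2C_*\sqrt{\log2}\,r^{-1/4}\le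 c_*/(24K^2)$; $\eta_{\rm W}=c_*/(24K^2)$. (4) With these constants, whenever $J=\{i\in I:|v_i-u_i|\le r^{-j}\}$, $n\ge1$, $2\le k\le\kappa$, $B$ is nonempty countable with $F_{I,u,j}(B)<\infty$, $w\in B$ and $\sup_{t\in B}d_{J,v,j+1}(t,w)^2\le2^{n+k}r^{-2(j+1)}$, there exists a partition of $B$, called a second subdivision of $B$ with index $n$, old parameters $(I,u,j)$ and current parameters $(J,v,j+1)$, into at most $N_n$ sets $D_p$ and a possibly empty remainder $E$, with points $t^p\in B$ such that $D_p\subset B_{d_{I,u,j}}(t^p,K^{-1}2^{n/2}r^{-j})$ and, if $E\ne\varnothing$, $F_{I,u,j}(B)\ge F_{J,v,j+1}(E)+\eta_{\rm W}2^nr^{-j}$. Construction. Let $T$ be countable, $0\in T$, $0<b(T)<\infty$. Choose $j_0\in\mathbb Z$ with $r^{-j_0}\le\operatorname{diam}_2(T)\le r^{-j_0+1}$. Refining partitions $\mathcal A_q$ of $T$ into nonempty sets are built inductively, each $A\in\mathcal A_q$ carrying an integer (level) $j_q(A)$, a center $\pi_q(A)\in T$ and a coordinate set $I_q(A)\subset\mathbb N$. Start: $\mathcal A_0=\{T\}$, $j_0(T)=j_0$, $\pi_0(T)=0$, $I_0(T)=\mathbb N$. Given $A\in\mathcal A_{q-1}$, $q\ge1$, write $j_m,\pi_m,I_m$ ($m\le q-1$) for the data of the element of $\mathcal A_m$ containing $A$. Consider the condition on an integer $n$: $$(\star)\qquad n\ge1,\quad 2\le q-n\le\kappa,\quad j_{n-1}=j_n,\quad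 j_n+1=j_{n+1}=\cdots=j_{q-1}.$$ (At most one $n$ satisfies it.) First rule (no $n$ satisfies $(\star)$): put $(I,u,j)=(I_{q-1},\pi_{q-1},j_{q-1})$ and take a greedy subdivision of $A$ at level $q$ with parameters $(I,u,j)$ and $m=N_{q-1}$. The children of $A$ in $\mathcal A_q$ are $R$ (if nonempty), which keeps the data $(I,u,j)$, and the sets $C_l$, with $j_q(C_l)=j+1$, $\pi_q(C_l)=w_l$, $I_q(C_l)=\{i\in I:|w_{l,i}-u_i|\le r^{-j}\}$. Second rule (some $n$ satisfies $(\star)$): put $(I,u,j)=(I_n,\pi_n,j_n)$ and $(J,v,j+1)=(I_{q-1},\pi_{q-1},j_{q-1})$; then $J=\{i\in I:|v_i-u_i|\le r^{-j}\}$. Take a greedy subdivision of $A$ at level $q$ with parameters $(J,v,j+1)$ and $m=N_{q-2}$. Its remainder $R$ (if nonempty) is a child keeping the data $(J,v,j+1)$. Each $C_l$ (center $w_l$) is further partitioned by a second subdivision with $B=C_l$, $w=w_l$, $k=q-n$, index $n$, old parameters $(I,u,j)$ and current parameters $(J,v,j+1)$, into sets $D_{l,p}$ and a possible remainder $E_l$; all nonempty $D_{l,p}$ and $E_l$ are children of $A$, all with data $j_q=j+2$, $\pi_q=w_l$, $I_q=\{i\in J:|w_{l,i}-v_i|\le r^{-j-1}\}$. For $t\in T$, $A_m(t)$ is the element of $\mathcal A_m$ containing $t$, and $j_m(t),\pi_m(t),I_m(t)$ are its data. *)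

theory Defs
  imports "HOL-Probability.Probability"
begin

text \<open>
  Coordinates are indexed by the type \<^typ>\<open>nat\<close> (a relabelling of the positive integers).  A vector
  over an index set \<open>I\<close> is identified with its extension by zero to all of \<^typ>\<open>nat\<close>; this changes
  neither norms nor the associated Bernoulli sums.
\<close>

definition ell2 :: "(nat \<Rightarrow> real) set" where
  "ell2 = {x. summable (\<lambda>i. (x i)\<^sup>2)}"

definition ell2_on :: "nat set \<Rightarrow> (nat \<Rightarrow> real) set" where
  "ell2_on I = {x \<in> ell2. \<forall>i. i \<notin> I \<longrightarrow> x i = 0}"

definition dist2 :: "(nat \<Rightarrow> real) \<Rightarrow> (nat \<Rightarrow> real) \<Rightarrow> real" where
  "dist2 x y = sqrt (\<Sum>i. (x i - y i)\<^sup>2)"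

definition diam2 :: "(nat \<Rightarrow> real) set \<Rightarrow> ereal" where
  "diam2 T = (SUP s\<in>T. SUP t\<in>T. ereal (dist2 s t))"

definition N :: "nat \<Rightarrow> nat" where
  "N n = 2 ^ (2 ^ n)"


subsection \<open>Bernoulli processes\<close>

text \<open>The coordinate functions on this product space are the independent random signs.\<close>

definition rademacher :: "(nat \<Rightarrow> real) measure" where
  "rademacher = PiM UNIV (\<lambda>_. measure_pmf (pmf_of_set {-1, 1}))"

lemma prob_space_rademacher: "prob_space rademacher"
  unfolding rademacher_def by (intro prob_space_PiM measure_pmf.prob_space_axioms)

lemma distr_rademacher_coordinate:
  "distr rademacher (measure_pmf (pmf_of_set {-1, 1})) (\<lambda>\<epsilon>. \<epsilon> i) = measure_pmf (pmf_of_set {-1, 1})"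
  unfolding rademacher_def by (rule distr_PiM_component) (auto intro: measure_pmf.prob_space_axioms)

lemma indep_vars_rademacher:
  "prob_space.indep_vars rademacher (\<lambda>_. measure_pmf (pmf_of_set {-1, 1})) (\<lambda>i \<epsilon>. \<epsilon> i) UNIV"
proof -
  interpret prob_space rademacher by (rule prob_space_rademacher)
  have id: "(\<lambda>x::nat \<Rightarrow> real. \<lambda>i\<in>UNIV. x i) = (\<lambda>x. x)"
    by (simp add: restrict_def)
  show ?thesis
    by (subst indep_vars_iff_distr_eq_PiM)
       (auto simp: distr_rademacher_coordinate id, auto simp: rademacher_def)
qed

text \<open>
  The series \<open>\<Sum>i. x i * \<epsilon> i\<close> of an \<^const>\<open>ell2\<close> vector converges almost surely and in mean square,
  so the value of \<^const>\<open>suminf\<close> on the exceptional null set is irrelevant, and all the maxima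
  below are integrable.
\<close>

definition bernoulli_sum :: "(nat \<Rightarrow> real) \<Rightarrow> (nat \<Rightarrow> real) \<Rightarrow> real" where
  "bernoulli_sum x \<epsilon> = (\<Sum>i. x i * \<epsilon> i)"

definition bernoulli_sup :: "('a \<Rightarrow> nat \<Rightarrow> real) \<Rightarrow> 'a set \<Rightarrow> ereal" where
  "bernoulli_sup z D =
     (SUP S \<in> {S. S \<subseteq> D \<and> finite S \<and> S \<noteq> {}}.
        ereal (\<integral>\<epsilon>. Max ((\<lambda>t. bernoulli_sum (z t) \<epsilon>) ` S) \<partial>rademacher))"

definition b :: "(nat \<Rightarrow> real) set \<Rightarrow> ereal" where
  "b T = bernoulli_sup (\<lambda>t. t) T"


subsection \<open>Truncated functionals and distances\<close>

definition trunc :: "real \<Rightarrow> int \<Rightarrow> real \<Rightarrow> real" where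
  "trunc r j x = max (- 3 * r powi (-j)) (min x (3 * r powi (-j)))"

definition phi :: "real \<Rightarrow> nat set \<Rightarrow> (nat \<Rightarrow> real) \<Rightarrow> int \<Rightarrow> (nat \<Rightarrow> real) \<Rightarrow> (nat \<Rightarrow> real)" where
  "phi r I u j t = (\<lambda>i. if i \<in> I then trunc r j (t i - u i) else 0)"

definition F :: "real \<Rightarrow> nat set \<Rightarrow> (nat \<Rightarrow> real) \<Rightarrow> int \<Rightarrow> (nat \<Rightarrow> real) set \<Rightarrow> ereal" where
  "F r I u j D = bernoulli_sup (phi r I u j) D"

definition d :: "real \<Rightarrow> nat set \<Rightarrow> (nat \<Rightarrow> real) \<Rightarrow> int \<Rightarrow> (nat \<Rightarrow> real) \<Rightarrow> (nat \<Rightarrow> real) \<Rightarrow> real" where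
  "d r I u j s t = dist2 (phi r I u j s) (phi r I u j t)"

definition closed_ball :: "('a \<Rightarrow> 'a \<Rightarrow> real) \<Rightarrow> 'a \<Rightarrow> real \<Rightarrow> 'a set" where
  "closed_ball \<delta> w \<rho> = {t. \<delta> t w \<le> \<rho>}"

definition close_coords ::
  "real \<Rightarrow> nat set \<Rightarrow> (nat \<Rightarrow> real) \<Rightarrow> int \<Rightarrow> (nat \<Rightarrow> real) \<Rightarrow> nat set" where
  "close_coords r I u j v = {i \<in> I. \<bar>v i - u i\<bar> \<le> r powi (-j)}"


subsection \<open>Subdivisions\<close>

definition partition_with_remainder :: "'a set \<Rightarrow> nat \<Rightarrow> (nat \<Rightarrow> 'a set) \<Rightarrow> 'a set \<Rightarrow> bool" where
  "partition_with_remainder A L C R \<longleftrightarrow>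
     (\<Union>l\<in>{1..L}. C l) \<union> R = A \<and> disjoint_family_on C {1..L} \<and> (\<forall>l\<in>{1..L}. C l \<inter> R = {})"

definition greedy_subdivision ::
  "real \<Rightarrow> real \<Rightarrow> real \<Rightarrow> nat \<Rightarrow> nat set \<Rightarrow> (nat \<Rightarrow> real) \<Rightarrow> int \<Rightarrow> nat \<Rightarrow> (nat \<Rightarrow> real) set \<Rightarrow>
   nat \<Rightarrow> (nat \<Rightarrow> (nat \<Rightarrow> real) set) \<Rightarrow> (nat \<Rightarrow> (nat \<Rightarrow> real)) \<Rightarrow> (nat \<Rightarrow> real) set \<Rightarrow> bool" where
  "greedy_subdivision K \<eta>\<^sub>G r q I u j m A L C w R \<longleftrightarrow>
     partition_with_remainder A L C R \<and> L \<le> m - 1 \<and>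
     (\<forall>l\<in>{1..L}. w l \<in> C l \<and>
        C l \<subseteq> closed_ball (d r I u j) (w l) (2 powr (real q / 2) * r powi (-j))) \<and>
     (\<forall>t\<in>R. \<forall>D. D \<noteq> {} \<and>
        D \<subseteq> R \<inter> closed_ball (d r I u j) t (inverse K * 2 powr (real q / 2) * r powi (-j)) \<longrightarrow>
        F r I u j A \<ge> F r I u j D + ereal (\<eta>\<^sub>G * 2 ^ q * r powi (-j)))"

text \<open>Old parameters \<open>(I, u, j)\<close>, current parameters \<open>(J, v, j + 1)\<close>; the sets \<open>D p\<close> may be empty.\<close>

definition second_subdivision ::
  "real \<Rightarrow> real \<Rightarrow> real \<Rightarrow> nat \<Rightarrow> nat set \<Rightarrow> (nat \<Rightarrow> real) \<Rightarrow> int \<Rightarrow> nat set \<Rightarrow> (nat \<Rightarrow> real) \<Rightarrow>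
   (nat \<Rightarrow> real) set \<Rightarrow>
   nat \<Rightarrow> (nat \<Rightarrow> (nat \<Rightarrow> real) set) \<Rightarrow> (nat \<Rightarrow> (nat \<Rightarrow> real)) \<Rightarrow> (nat \<Rightarrow> real) set \<Rightarrow> bool" where
  "second_subdivision K \<eta>\<^sub>W r n I u j J v B P D tp E \<longleftrightarrow>
     partition_with_remainder B P D E \<and> P \<le> N n \<and>
     (\<forall>p\<in>{1..P}. tp p \<in> B \<and>
        D p \<subseteq> closed_ball (d r I u j) (tp p) (inverse K * 2 powr (real n / 2) * r powi (-j))) \<and>
     (E \<noteq> {} \<longrightarrow>
        F r I u j B \<ge> F r J v (j + 1) E + ereal (\<eta>\<^sub>W * 2 ^ n * r powi (-j)))"


subsection \<open>The constants\<close>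

definition greedy_constants :: "real \<Rightarrow> real \<Rightarrow> bool" where
  "greedy_constants K \<eta>\<^sub>G \<longleftrightarrow> K \<ge> 1 \<and> \<eta>\<^sub>G > 0 \<and>
     (\<forall>r q I u j A m.
        r \<ge> 2 \<and> q \<ge> 1 \<and> u \<in> ell2 \<and> A \<subseteq> ell2 \<and> A \<noteq> {} \<and> countable A \<and> F r I u j A < \<infinity> \<and>
        (m = N (q - 1) \<or> (q \<ge> 2 \<and> m = N (q - 2))) \<longrightarrow>
        (\<exists>L C w R. greedy_subdivision K \<eta>\<^sub>G r q I u j m A L C w R))"

text \<open>
  The index sets \<open>\<Lambda>\<^sub>1\<close>, \<open>\<Lambda>\<^sub>2\<close> are disjoint, so the pair \<open>(x, y)\<close> is the sum of the zero extensions.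
  Every countable set embeds into \<^typ>\<open>nat \<Rightarrow> real\<close>, and countably many square-summable families
  have countable joint support, so fixing these types loses no generality.
\<close>

definition minoration_constants :: "real \<Rightarrow> real \<Rightarrow> bool" where
  "minoration_constants c C \<longleftrightarrow> c > 0 \<and> C > 0 \<and>
     (\<forall>(B :: (nat \<Rightarrow> real) set) \<Lambda>\<^sub>1 \<Lambda>\<^sub>2 x y z \<beta> \<delta>.
        B \<noteq> {} \<and> countable B \<and> \<Lambda>\<^sub>1 \<inter> \<Lambda>\<^sub>2 = {} \<and>
        (\<forall>t\<in>B. x t \<in> ell2_on \<Lambda>\<^sub>1) \<and> (\<forall>t\<in>B. y t \<in> ell2_on \<Lambda>\<^sub>2) \<and>
        z = (\<lambda>t i. x t i + y t i) \<and> bernoulli_sup z B < \<infinity> \<and> \<beta> > 0 \<and>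
        (\<forall>s\<in>B. \<forall>t\<in>B. (\<forall>i. \<bar>z s i - z t i\<bar> \<le> \<beta>) \<and> dist2 (y s) (y t) \<le> \<delta>) \<longrightarrow>
        (\<forall>m \<rho>. m \<ge> (2::nat) \<and> \<rho> > 0 \<longrightarrow>
           (\<exists>tp. (\<forall>p\<in>{1..m}. tp p \<in> B) \<and>
              (let R = B - (\<Union>p\<in>{1..m}. closed_ball (\<lambda>s t. dist2 (z s) (z t)) (tp p) \<rho>)
               in R = {} \<or>
                  bernoulli_sup y R \<le> bernoulli_sup z B
                    - ereal (c * min (\<rho> * sqrt (ln (real m))) (\<rho>\<^sup>2 / \<beta>))
                    + ereal (C * \<delta> * sqrt (ln (real m)))))))"

definition second_constants :: "real \<Rightarrow> real \<Rightarrow> real \<Rightarrow> nat \<Rightarrow> bool" where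
  "second_constants K \<eta>\<^sub>W r \<kappa> \<longleftrightarrow>
     (\<forall>I u j J v n k B w.
        u \<in> ell2 \<and> v \<in> ell2 \<and> J = close_coords r I u j v \<and> n \<ge> 1 \<and> 2 \<le> k \<and> k \<le> \<kappa> \<and>
        B \<subseteq> ell2 \<and> B \<noteq> {} \<and> countable B \<and> F r I u j B < \<infinity> \<and> w \<in> B \<and>
        (\<forall>t\<in>B. (d r J v (j + 1) t w)\<^sup>2 \<le> 2 ^ (n + k) * r powi (- 2 * (j + 1))) \<longrightarrow>
        (\<exists>P D tp E. second_subdivision K \<eta>\<^sub>W r n I u j J v B P D tp E))"


subsection \<open>The construction\<close>

text \<open>
  For a partition \<open>P\<close> into nonempty sets this is the member of \<open>P\<close> containing the nonempty set \<open>S\<close>.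
  The data attached to a set depend on the generation as well as on the set, because the same set
  may occur in several consecutive partitions.
\<close>

definition member_containing :: "'a set set \<Rightarrow> 'a set \<Rightarrow> 'a set" where
  "member_containing P S = (THE A. A \<in> P \<and> S \<subseteq> A)"

text \<open>Condition \<open>(\<star>)\<close> on \<open>n\<close>, where \<open>jm m\<close> is the level of the ancestor in generation \<open>m\<close>.\<close>

definition star :: "nat \<Rightarrow> (nat \<Rightarrow> int) \<Rightarrow> nat \<Rightarrow> nat \<Rightarrow> bool" where
  "star \<kappa> jm q n \<longleftrightarrow> n \<ge> 1 \<and> n + 2 \<le> q \<and> q \<le> n + \<kappa> \<and> jm (n - 1) = jm n \<and>
     (\<forall>m\<in>{n + 1..q - 1}. jm m = jm n + 1)"

text \<open>
  In both rules \<open>\<C>\<close> is the set of children of \<open>A\<close> in generation \<open>q\<close>, and \<open>Iq\<close>, \<open>\<pi>q\<close>, \<open>jq\<close> are the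
  data maps of generation \<open>q\<close>.
\<close>

definition first_rule ::
  "real \<Rightarrow> real \<Rightarrow> real \<Rightarrow> nat \<Rightarrow> nat set \<Rightarrow> (nat \<Rightarrow> real) \<Rightarrow> int \<Rightarrow> (nat \<Rightarrow> real) set \<Rightarrow>
   (nat \<Rightarrow> real) set set \<Rightarrow> ((nat \<Rightarrow> real) set \<Rightarrow> nat set) \<Rightarrow>
   ((nat \<Rightarrow> real) set \<Rightarrow> (nat \<Rightarrow> real)) \<Rightarrow> ((nat \<Rightarrow> real) set \<Rightarrow> int) \<Rightarrow> bool" where
  "first_rule K \<eta>\<^sub>G r q I u j A \<C> Iq \<pi>q jq \<longleftrightarrow>
     (\<exists>L C w R. greedy_subdivision K \<eta>\<^sub>G r q I u j (N (q - 1)) A L C w R \<and>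
        \<C> = (C ` {1..L} \<union> {R}) - {{}} \<and>
        (R \<noteq> {} \<longrightarrow> Iq R = I \<and> \<pi>q R = u \<and> jq R = j) \<and>
        (\<forall>l\<in>{1..L}. jq (C l) = j + 1 \<and> \<pi>q (C l) = w l \<and>
           Iq (C l) = close_coords r I u j (w l)))"

definition second_rule ::
  "real \<Rightarrow> real \<Rightarrow> real \<Rightarrow> real \<Rightarrow> nat \<Rightarrow> nat \<Rightarrow> nat set \<Rightarrow> (nat \<Rightarrow> real) \<Rightarrow> int \<Rightarrow>
   nat set \<Rightarrow> (nat \<Rightarrow> real) \<Rightarrow> (nat \<Rightarrow> real) set \<Rightarrow>
   (nat \<Rightarrow> real) set set \<Rightarrow> ((nat \<Rightarrow> real) set \<Rightarrow> nat set) \<Rightarrow>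
   ((nat \<Rightarrow> real) set \<Rightarrow> (nat \<Rightarrow> real)) \<Rightarrow> ((nat \<Rightarrow> real) set \<Rightarrow> int) \<Rightarrow> bool" where
  "second_rule K \<eta>\<^sub>G \<eta>\<^sub>W r q n I u j J v A \<C> Iq \<pi>q jq \<longleftrightarrow>
     (\<exists>L C w R P D tp E. greedy_subdivision K \<eta>\<^sub>G r q J v (j + 1) (N (q - 2)) A L C w R \<and>
        (\<forall>l\<in>{1..L}. second_subdivision K \<eta>\<^sub>W r n I u j J v (C l) (P l) (D l) (tp l) (E l)) \<and>
        \<C> = ((\<Union>l\<in>{1..L}. D l ` {1..P l} \<union> {E l}) \<union> {R}) - {{}} \<and>
        (R \<noteq> {} \<longrightarrow> Iq R = J \<and> \<pi>q R = v \<and> jq R = j + 1) \<and>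
        (\<forall>l\<in>{1..L}. \<forall>S \<in> (D l ` {1..P l} \<union> {E l}) - {{}}.
           jq S = j + 2 \<and> \<pi>q S = w l \<and> Iq S = close_coords r J v (j + 1) (w l)))"

text \<open>
  In the second rule the current level is \<open>j + 1\<close> by \<open>(\<star>)\<close>.  The hypotheses under which
  \<^const>\<open>second_constants\<close> provides the second subdivisions, with \<open>B = C l\<close>, centre \<open>w l\<close>
  and \<open>k = q - n\<close>, hold automatically here.
\<close>

definition partition_construction ::
  "real \<Rightarrow> real \<Rightarrow> real \<Rightarrow> real \<Rightarrow> nat \<Rightarrow> (nat \<Rightarrow> real) set \<Rightarrow>
   (nat \<Rightarrow> (nat \<Rightarrow> real) set set) \<Rightarrow> (nat \<Rightarrow> (nat \<Rightarrow> real) set \<Rightarrow> nat set) \<Rightarrow>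
   (nat \<Rightarrow> (nat \<Rightarrow> real) set \<Rightarrow> (nat \<Rightarrow> real)) \<Rightarrow> (nat \<Rightarrow> (nat \<Rightarrow> real) set \<Rightarrow> int) \<Rightarrow> bool" where
  "partition_construction K \<eta>\<^sub>G \<eta>\<^sub>W r \<kappa> T \<A> I \<pi> j \<longleftrightarrow>
     (\<exists>j\<^sub>0. ereal (r powi (- j\<^sub>0)) \<le> diam2 T \<and> diam2 T \<le> ereal (r powi (- j\<^sub>0 + 1)) \<and>
        \<A> 0 = {T} \<and> j 0 T = j\<^sub>0 \<and> \<pi> 0 T = (\<lambda>_. 0) \<and> I 0 T = UNIV) \<and>
     (\<forall>q. partition_on T (\<A> q)) \<and>
     (\<forall>q\<ge>1. \<forall>A \<in> \<A> (q - 1).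
        let jm = (\<lambda>m. j m (member_containing (\<A> m) A));
            \<pi>m = (\<lambda>m. \<pi> m (member_containing (\<A> m) A));
            Im = (\<lambda>m. I m (member_containing (\<A> m) A));
            \<C> = {S \<in> \<A> q. S \<subseteq> A}
        in ((\<nexists>n. star \<kappa> jm q n) \<longrightarrow>
              first_rule K \<eta>\<^sub>G r q (Im (q - 1)) (\<pi>m (q - 1)) (jm (q - 1)) A \<C> (I q) (\<pi> q) (j q)) \<and>
           (\<forall>n. star \<kappa> jm q n \<longrightarrow>
              second_rule K \<eta>\<^sub>G \<eta>\<^sub>W r q n (Im n) (\<pi>m n) (jm n) (Im (q - 1)) (\<pi>m (q - 1))
                A \<C> (I q) (\<pi> q) (j q)))"

end

theory Submission
  imports Defs
begin

text \<open>
  Fix \<open>t \<in> T\<close> and follow the branch of partition elements \<open>A\<^sub>0 \<supseteq> A\<^sub>1 \<supseteq> \<dots>\<close> containing \<open>t\<close>, with levels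
  \<open>j\<^sub>n\<close> and with \<open>G\<^sub>n = F (A\<^sub>n)\<close> computed from the data of \<open>A\<^sub>n\<close>.  The contraction principle
  (\<open>bernoulli_sup_contraction\<close>) shows that changing to the data of a child can only decrease the
  functional (\<open>F_next_level_le\<close>): truncating around the new centre at the next level is a
  contraction of the old truncation.  Hence \<open>G\<close> decreases from a value at most \<open>b T\<close>.

  Put \<open>a\<^sub>n = 2 ^ n * r powi (- j\<^sub>n)\<close>.  This quantity doubles when the level stays and is at least halved
  when the level rises, so \<open>\<Sum> a\<^sub>n\<close> is controlled by its first term and by its \<^emph>\<open>peaks\<close>, the indices
  \<open>n \<ge> 1\<close> with \<open>j\<^sub>n\<^sub>-\<^sub>1 = j\<^sub>n < j\<^sub>n\<^sub>+\<^sub>1\<close>.  Let \<open>n\<close> be a peak and let \<open>q\<close> be the next index after \<open>n + 1\<close> at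
  which the level rises again.

  If \<open>q \<le> n + \<kappa>\<close>, then the second rule was applied at step \<open>q\<close> with this \<open>n\<close>.  Either
  the functional has dropped by a multiple of \<open>a\<^sub>n\<close> when passing from the data of \<open>n\<close> to those of
  \<open>q\<close>, or \<open>A\<^sub>q\<close> lies in a small ball for the metric of step \<open>n\<close>.  In the latter case the greedy
  subdivision at step \<open>n\<close> applies: as the level stayed there, \<open>A\<^sub>n\<close> is the remainder, and the
  functional of a small subset of the remainder is below that of the subdivided set \<open>A\<^sub>n\<^sub>-\<^sub>1\<close> by a
  multiple of \<open>a\<^sub>n\<close>.  In both cases \<open>G\<^sub>n\<^sub>-\<^sub>1 - G\<^sub>q \<ge> \<eta> * a\<^sub>n\<close>.  The intervals \<open>[n - 1, n + \<kappa>]\<close> have bounded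
  overlap, so these peaks contribute at most a multiple of \<open>G\<^sub>0\<close>.

  If \<open>q > n + \<kappa>\<close>, then \<open>2 ^ \<kappa> \<ge> 2 * r\<close> makes the next peak at least twice as high, and the
  peaks of this kind are absorbed by their successors.  A next rise always exists: while the level
  stays, the greedy subdivision applied to singletons gives \<open>\<eta> * a\<^sub>n \<le> G\<^sub>0\<close>, whereas \<open>a\<close> would
  grow without bound.

  The locale \<open>level_sequence\<close> isolates this summation argument, and \<open>branch_level_sequence\<close> shows that
  it applies to the branch.  The first term \<open>a\<^sub>0\<close> is at most the diameter of
  \<open>T\<close>, which is at most \<open>8 * b T\<close> by Khintchine's inequality (\<open>diam2_le_b\<close>).

  The probabilistic facts concern infinite series, so almost sure convergence of
  \<open>\<Sum> x\<^sub>i \<epsilon>\<^sub>i\<close> for square summable \<open>x\<close> is established first.  Independence and symmetry of the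
  signs enter through a single fact: flipping one sign preserves their joint law (\<open>distr_flip\<close>).
\<close>

section \<open>Random signs and coordinate flips\<close>

interpretation rademacher: prob_space rademacher
  by (rule prob_space_rademacher)

lemma space_rademacher [simp]: "space rademacher = UNIV"
  by (simp add: rademacher_def space_PiM)

text \<open>
  The law on the coordinate spaces is discrete, with all sets measurable; what is needed later is
  measurability with respect to the Borel sets.
\<close>

lemma measurable_coordinate [measurable]: "(\<lambda>\<epsilon>. \<epsilon> i) \<in> borel_measurable rademacher"
proof -
  have "(\<lambda>\<epsilon>. \<epsilon> i) \<in> measurable rademacher (measure_pmf (pmf_of_set {-1, 1::real}))"
    unfolding rademacher_def by measurable
  then show ?thesis
    by (rule measurable_compose) simp
qed

lemma AE_coordinate: "AE \<epsilon> in rademacher. \<forall>i. \<bar>\<epsilon> i\<bar> = 1"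
proof -
  have "AE \<epsilon> in rademacher. \<bar>\<epsilon> i\<bar> = 1" for i
    unfolding rademacher_def
    by (rule AE_PiM_component)
       (auto intro: measure_pmf.prob_space_axioms simp: AE_measure_pmf_iff)
  then show ?thesis
    by (simp add: AE_all_countable)
qed

definition flip :: "nat \<Rightarrow> (nat \<Rightarrow> real) \<Rightarrow> nat \<Rightarrow> real" where
  "flip k \<epsilon> = \<epsilon>(k := - \<epsilon> k)"

lemma flip_apply: "flip k \<epsilon> i = (if i = k then - \<epsilon> k else \<epsilon> i)"
  by (simp add: flip_def)

lemma measurable_flip [measurable]: "flip k \<in> measurable rademacher rademacher"
  unfolding rademacher_def
proof (rule measurable_PiM_single')
  fix i :: nat
  let ?N = "measure_pmf (pmf_of_set {-1, 1::real})"
  have *: "(\<lambda>\<omega>. \<omega> m) \<in> measurable (Pi\<^sub>M UNIV (\<lambda>_::nat. ?N)) ?N" for m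
    by measurable
  have "(\<lambda>\<omega>. - \<omega> k) \<in> measurable (Pi\<^sub>M UNIV (\<lambda>_::nat. ?N)) ?N"
    by (rule measurable_compose[OF *]) simp
  with * show "(\<lambda>\<omega>. flip k \<omega> i) \<in> measurable (Pi\<^sub>M UNIV (\<lambda>_::nat. ?N)) ?N"
    by (simp add: flip_apply)
qed auto

text \<open>
  On cylinder sets a flip replaces one factor by its reflection, and the uniform law on
  \<open>{-1, 1}\<close> is symmetric.
\<close>

lemma distr_flip: "distr rademacher rademacher (flip k) = rademacher"
proof -
  let ?N = "measure_pmf (pmf_of_set {-1, 1::real})"
  let ?M = "\<lambda>_::nat. ?N"
  have ps: "prob_space ?N" by (rule measure_pmf.prob_space_axioms)
  have neg: "emeasure ?N (uminus -` S) = emeasure ?N S" for S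
  proof -
    have "emeasure ?N (uminus -` S) = emeasure (measure_pmf (map_pmf uminus (pmf_of_set {-1, 1::real}))) S"
      by simp
    also have "map_pmf uminus (pmf_of_set {-1, 1::real}) = pmf_of_set {-1, 1}"
      by (subst map_pmf_of_set_inj) (auto simp: insert_commute)
    finally show ?thesis .
  qed
  show ?thesis
  proof (rule measure_eqI_PiM_infinite[where I=UNIV and M="?M"])
    show "sets (distr rademacher rademacher (flip k)) = sets (Pi\<^sub>M UNIV ?M)"
      "sets rademacher = sets (Pi\<^sub>M UNIV ?M)"
      by (simp_all add: rademacher_def)
    show "finite_measure (distr rademacher rademacher (flip k))"
      using rademacher.prob_space_distr[OF measurable_flip]
      by (rule prob_space.finite_measure)
    fix A :: "nat \<Rightarrow> real set" and J :: "nat set"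
    assume J: "finite J" "J \<subseteq> UNIV"
    let ?A' = "A(k := uminus -` A k)"
    have s: "prod_emb UNIV ?M J (Pi\<^sub>E J A) \<in> sets rademacher"
      unfolding rademacher_def using J by (intro sets_PiM_I) auto
    have pre: "flip k -` prod_emb UNIV ?M J (Pi\<^sub>E J A) = prod_emb UNIV ?M J (Pi\<^sub>E J ?A')"
      by (auto simp: prod_emb_iff restrict_PiE_iff Pi_iff flip_apply split: if_splits)
    have "emeasure (distr rademacher rademacher (flip k)) (prod_emb UNIV ?M J (Pi\<^sub>E J A))
      = emeasure rademacher (prod_emb UNIV ?M J (Pi\<^sub>E J ?A'))"
      by (simp add: emeasure_distr[OF measurable_flip s] pre)
    also have "\<dots> = (\<Prod>i\<in>J. emeasure ?N (?A' i))"
      unfolding rademacher_def using J ps by (intro emeasure_PiM_emb) auto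
    also have "\<dots> = (\<Prod>i\<in>J. emeasure ?N (A i))"
      by (intro prod.cong) (auto simp: neg)
    also have "\<dots> = emeasure rademacher (prod_emb UNIV ?M J (Pi\<^sub>E J A))"
      unfolding rademacher_def using J ps by (intro emeasure_PiM_emb[symmetric]) auto
    finally show "emeasure (distr rademacher rademacher (flip k)) (prod_emb UNIV ?M J (Pi\<^sub>E J A))
      = emeasure rademacher (prod_emb UNIV ?M J (Pi\<^sub>E J A))" .
  qed
qed

lemma integral_flip:
  fixes f :: "(nat \<Rightarrow> real) \<Rightarrow> real"
  assumes "f \<in> borel_measurable rademacher"
  shows "(\<integral>\<epsilon>. f (flip k \<epsilon>) \<partial>rademacher) = (\<integral>\<epsilon>. f \<epsilon> \<partial>rademacher)"
proof -
  have "(\<integral>\<epsilon>. f \<epsilon> \<partial>distr rademacher rademacher (flip k)) = (\<integral>\<epsilon>. f (flip k \<epsilon>) \<partial>rademacher)"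
    by (rule integral_distr[OF measurable_flip assms])
  then show ?thesis by (simp add: distr_flip)
qed

lemma integrable_flip:
  fixes f :: "(nat \<Rightarrow> real) \<Rightarrow> real"
  assumes "integrable rademacher f"
  shows "integrable rademacher (\<lambda>\<epsilon>. f (flip k \<epsilon>))"
  by (rule integrable_distr[OF measurable_flip]) (simp add: distr_flip assms)

text \<open>
  The integrand changes sign under the flip, so its integral equals its own negative; when the
  integral does not exist, its value is \<open>0\<close> by convention.  This orthogonality drives all moment
  computations below.
\<close>

lemma integral_odd_coordinate:
  fixes g :: "(nat \<Rightarrow> real) \<Rightarrow> real"
  assumes [measurable]: "g \<in> borel_measurable rademacher"
    and inv: "\<And>\<epsilon>. g (flip k \<epsilon>) = g \<epsilon>"
  shows "(\<integral>\<epsilon>. g \<epsilon> * \<epsilon> k \<partial>rademacher) = 0"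
proof -
  have "(\<integral>\<epsilon>. g \<epsilon> * \<epsilon> k \<partial>rademacher) = (\<integral>\<epsilon>. g (flip k \<epsilon>) * flip k \<epsilon> k \<partial>rademacher)"
    by (rule integral_flip[symmetric, where f = "\<lambda>\<epsilon>. g \<epsilon> * \<epsilon> k"]) measurable
  also have "\<dots> = - (\<integral>\<epsilon>. g \<epsilon> * \<epsilon> k \<partial>rademacher)"
    by (simp add: inv flip_apply)
  finally show ?thesis by simp
qed

section \<open>Almost sure convergence of Bernoulli series\<close>

definition partial_sum :: "(nat \<Rightarrow> real) \<Rightarrow> nat \<Rightarrow> (nat \<Rightarrow> real) \<Rightarrow> real" where
  "partial_sum x n \<epsilon> = (\<Sum>i<n. x i * \<epsilon> i)"

lemma partial_sum_Suc: "partial_sum x (Suc n) \<epsilon> = partial_sum x n \<epsilon> + x n * \<epsilon> n"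
  by (simp add: partial_sum_def)

lemma measurable_partial_sum [measurable]: "partial_sum x n \<in> borel_measurable rademacher"
  unfolding partial_sum_def by measurable

lemma partial_sum_flip: "n \<le> k \<Longrightarrow> partial_sum x n (flip k \<epsilon>) = partial_sum x n \<epsilon>"
  unfolding partial_sum_def by (intro sum.cong) (auto simp: flip_apply)

lemma AE_partial_sum_bounded: "AE \<epsilon> in rademacher. \<bar>partial_sum x n \<epsilon>\<bar> \<le> (\<Sum>i<n. \<bar>x i\<bar>)"
  using AE_coordinate
proof eventually_elim
  case (elim \<epsilon>)
  have "\<bar>partial_sum x n \<epsilon>\<bar> \<le> (\<Sum>i<n. \<bar>x i * \<epsilon> i\<bar>)"
    unfolding partial_sum_def by (rule sum_abs)
  then show ?case using elim by (simp add: abs_mult)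
qed

lemma integrable_partial_sum_power: "integrable rademacher (\<lambda>\<epsilon>. partial_sum x n \<epsilon> ^ p)"
proof (rule rademacher.integrable_const_bound)
  show "AE \<epsilon> in rademacher. norm (partial_sum x n \<epsilon> ^ p) \<le> (\<Sum>i<n. \<bar>x i\<bar>) ^ p"
    using AE_partial_sum_bounded[of x n]
    by eventually_elim (auto simp: power_abs intro: power_mono)
qed measurable

lemma integral_partial_sum: "(\<integral>\<epsilon>. partial_sum x n \<epsilon> \<partial>rademacher) = 0"
proof (induction n)
  case 0
  then show ?case by (simp add: partial_sum_def)
next
  case (Suc n)
  have i1: "integrable rademacher (partial_sum x n)"
    using integrable_partial_sum_power[of x n 1] by simp
  have i2: "integrable rademacher (\<lambda>\<epsilon>. x n * \<epsilon> n)"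
  proof -
    have "integrable rademacher (\<lambda>\<epsilon>. partial_sum x (Suc n) \<epsilon> - partial_sum x n \<epsilon>)"
      using i1 integrable_partial_sum_power[of x "Suc n" 1] by (intro Bochner_Integration.integrable_diff) simp_all
    then show ?thesis by (simp add: partial_sum_Suc)
  qed
  have "(\<integral>\<epsilon>. x n * \<epsilon> n \<partial>rademacher) = 0"
    by (rule integral_odd_coordinate[where g = "\<lambda>_. x n"]) auto
  then show ?case
    using Suc i1 i2 by (simp add: partial_sum_Suc)
qed

text \<open>
  The partial sums frozen as soon as their modulus reaches \<open>\<theta>\<close>.  The stopping condition refers to
  the frozen sum itself, which avoids a decomposition according to the first passage time.
\<close>

fun stopped_sum :: "(nat \<Rightarrow> real) \<Rightarrow> real \<Rightarrow> nat \<Rightarrow> (nat \<Rightarrow> real) \<Rightarrow> real" where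
  "stopped_sum x \<theta> 0 \<epsilon> = 0"
| "stopped_sum x \<theta> (Suc n) \<epsilon> =
     stopped_sum x \<theta> n \<epsilon> + (if \<bar>stopped_sum x \<theta> n \<epsilon>\<bar> < \<theta> then x n * \<epsilon> n else 0)"

lemma measurable_stopped_sum [measurable]: "stopped_sum x \<theta> n \<in> borel_measurable rademacher"
proof (induction n)
  case 0
  have "stopped_sum x \<theta> 0 = (\<lambda>_. 0)" by auto
  then show ?case by simp
next
  case (Suc n)
  note Suc[measurable]
  have "stopped_sum x \<theta> (Suc n) = (\<lambda>\<epsilon>. stopped_sum x \<theta> n \<epsilon> + (if \<bar>stopped_sum x \<theta> n \<epsilon>\<bar> < \<theta> then x n * \<epsilon> n else 0))"
    by auto
  moreover have "\<dots> \<in> borel_measurable rademacher"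
    by measurable
  ultimately show ?case by simp
qed

lemma stopped_sum_flip: "n \<le> k \<Longrightarrow> stopped_sum x \<theta> n (flip k \<epsilon>) = stopped_sum x \<theta> n \<epsilon>"
  by (induction n) (auto simp: flip_apply)

lemma AE_stopped_sum_bounded: "AE \<epsilon> in rademacher. \<bar>stopped_sum x \<theta> n \<epsilon>\<bar> \<le> (\<Sum>i<n. \<bar>x i\<bar>)"
  using AE_coordinate
proof eventually_elim
  case (elim \<epsilon>)
  show ?case
  proof (induction n)
    case (Suc n)
    have "\<bar>x n * \<epsilon> n\<bar> = \<bar>x n\<bar>" using elim by (simp add: abs_mult)
    then show ?case using Suc by auto
  qed simp
qed

lemma integrable_stopped_sum_square:
  "integrable rademacher (\<lambda>\<epsilon>. (stopped_sum x \<theta> n \<epsilon>)\<^sup>2)"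
proof (rule rademacher.integrable_const_bound)
  show "AE \<epsilon> in rademacher. norm ((stopped_sum x \<theta> n \<epsilon>)\<^sup>2) \<le> (\<Sum>i<n. \<bar>x i\<bar>)\<^sup>2"
    using AE_stopped_sum_bounded[of x \<theta> n]
    by eventually_elim (auto simp: abs_le_square_iff[symmetric])
qed measurable

lemma stopped_sum_cases:
  "(\<forall>k\<le>n. \<bar>partial_sum x k \<epsilon>\<bar> < \<theta>) \<and> stopped_sum x \<theta> n \<epsilon> = partial_sum x n \<epsilon> \<or>
   \<theta> \<le> \<bar>stopped_sum x \<theta> n \<epsilon>\<bar>"
proof (induction n)
  case 0
  then show ?case by (auto simp: partial_sum_def)
next
  case (Suc n)
  then show ?case
    by (auto simp: partial_sum_Suc le_Suc_eq)
qed

text \<open>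
  Stopping only removes terms, and the decision to add the next term does not depend on its sign, so
  the increments remain orthogonal.
\<close>

lemma integral_stopped_sum_square:
  "(\<integral>\<epsilon>. (stopped_sum x \<theta> n \<epsilon>)\<^sup>2 \<partial>rademacher) \<le> (\<Sum>i<n. (x i)\<^sup>2)"
proof (induction n)
  case (Suc n)
  let ?Y = "stopped_sum x \<theta> n"
  let ?g = "\<lambda>\<epsilon>. if \<bar>?Y \<epsilon>\<bar> < \<theta> then 2 * ?Y \<epsilon> * x n else 0"
  let ?h = "\<lambda>\<epsilon>. if \<bar>?Y \<epsilon>\<bar> < \<theta> then (x n)\<^sup>2 else 0"
  have bd: "AE \<epsilon> in rademacher. \<bar>?Y \<epsilon>\<bar> \<le> (\<Sum>i<n. \<bar>x i\<bar>)"
    by (rule AE_stopped_sum_bounded)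
  have iY: "integrable rademacher (\<lambda>\<epsilon>. (?Y \<epsilon>)\<^sup>2)"
    by (rule integrable_stopped_sum_square)
  have ig: "integrable rademacher (\<lambda>\<epsilon>. ?g \<epsilon> * \<epsilon> n)"
  proof (rule rademacher.integrable_const_bound)
    show "AE \<epsilon> in rademacher. norm (?g \<epsilon> * \<epsilon> n) \<le> 2 * (\<Sum>i<n. \<bar>x i\<bar>) * \<bar>x n\<bar>"
      using bd AE_coordinate
    proof eventually_elim
      case (elim \<epsilon>)
      then show ?case
        using mult_right_mono[OF elim(1), of "\<bar>x n\<bar>"] sum_nonneg[of "{..<n}" "\<lambda>i. \<bar>x i\<bar>"]
        by (auto simp: abs_mult)
    qed
  qed measurable
  have ih: "integrable rademacher ?h"
    by (rule rademacher.integrable_const_bound[where B="(x n)\<^sup>2"]) auto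
  have eq: "AE \<epsilon> in rademacher. (stopped_sum x \<theta> (Suc n) \<epsilon>)\<^sup>2 = (?Y \<epsilon>)\<^sup>2 + ?g \<epsilon> * \<epsilon> n + ?h \<epsilon>"
    using AE_coordinate
  proof eventually_elim
    case (elim \<epsilon>)
    have "(\<epsilon> n)\<^sup>2 = 1" using elim by (metis power2_abs one_power2)
    then show ?case by (auto simp: power2_sum power_mult_distrib)
  qed
  have "(\<integral>\<epsilon>. (stopped_sum x \<theta> (Suc n) \<epsilon>)\<^sup>2 \<partial>rademacher)
      = (\<integral>\<epsilon>. (?Y \<epsilon>)\<^sup>2 + ?g \<epsilon> * \<epsilon> n + ?h \<epsilon> \<partial>rademacher)"
    by (rule integral_cong_AE[OF _ _ eq]) measurable
  also have "\<dots> = (\<integral>\<epsilon>. (?Y \<epsilon>)\<^sup>2 \<partial>rademacher) + (\<integral>\<epsilon>. ?g \<epsilon> * \<epsilon> n \<partial>rademacher) + (\<integral>\<epsilon>. ?h \<epsilon> \<partial>rademacher)"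
    using iY ig ih by simp
  also have "(\<integral>\<epsilon>. ?g \<epsilon> * \<epsilon> n \<partial>rademacher) = 0"
    by (rule integral_odd_coordinate) (measurable, simp add: stopped_sum_flip)
  also have "(\<integral>\<epsilon>. ?h \<epsilon> \<partial>rademacher) \<le> (\<integral>\<epsilon>. (x n)\<^sup>2 \<partial>rademacher)"
    by (rule integral_mono[OF ih]) auto
  finally show ?case using Suc by (simp add: rademacher.prob_space[unfolded space_rademacher])
qed simp

text \<open>
  If some partial sum up to \<open>n\<close> reaches \<open>\<theta>\<close>, then the stopped sum still has modulus at least \<open>\<theta>\<close>
  at time \<open>n\<close>, so a maximal event becomes an event about a single variable and Markov's inequality
  applies.
\<close>

lemma kolmogorov_maximal_inequality:
  assumes "\<theta> > 0"
  shows "measure rademacher {\<epsilon>. \<exists>k\<le>n. \<theta> \<le> \<bar>partial_sum x k \<epsilon>\<bar>} \<le> (\<Sum>i<n. (x i)\<^sup>2) / \<theta>\<^sup>2"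
proof -
  let ?Y = "stopped_sum x \<theta> n"
  have iY: "integrable rademacher (\<lambda>\<epsilon>. (?Y \<epsilon>)\<^sup>2)"
    by (rule integrable_stopped_sum_square)
  have "measure rademacher {\<epsilon>. \<exists>k\<le>n. \<theta> \<le> \<bar>partial_sum x k \<epsilon>\<bar>}
      \<le> measure rademacher {\<epsilon> \<in> space rademacher. \<theta>\<^sup>2 \<le> (?Y \<epsilon>)\<^sup>2}"
  proof (rule rademacher.finite_measure_mono)
    show "{\<epsilon>. \<exists>k\<le>n. \<theta> \<le> \<bar>partial_sum x k \<epsilon>\<bar>} \<subseteq> {\<epsilon> \<in> space rademacher. \<theta>\<^sup>2 \<le> (?Y \<epsilon>)\<^sup>2}"
    proof
      fix \<epsilon> assume "\<epsilon> \<in> {\<epsilon>. \<exists>k\<le>n. \<theta> \<le> \<bar>partial_sum x k \<epsilon>\<bar>}"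
      then have "\<theta> \<le> \<bar>?Y \<epsilon>\<bar>"
        using stopped_sum_cases[of n x \<epsilon> \<theta>] by auto
      then show "\<epsilon> \<in> {\<epsilon> \<in> space rademacher. \<theta>\<^sup>2 \<le> (?Y \<epsilon>)\<^sup>2}"
        using assms by (simp add: abs_le_square_iff[symmetric])
    qed
  qed measurable
  also have "\<dots> \<le> (\<integral>\<epsilon>. (?Y \<epsilon>)\<^sup>2 \<partial>rademacher) / \<theta>\<^sup>2"
    by (rule integral_Markov_inequality_measure[where A="{}"]) (use iY assms in auto)
  also have "\<dots> \<le> (\<Sum>i<n. (x i)\<^sup>2) / \<theta>\<^sup>2"
    by (rule divide_right_mono[OF integral_stopped_sum_square]) simp
  finally show ?thesis .
qed

text \<open>
  The maximal inequality for the vector with its first \<open>m\<close> entries erased, uniformly in the number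
  of terms.
\<close>

lemma tail_exceeds_small:
  assumes x: "x \<in> ell2" and "\<theta> > 0"
  shows "measure rademacher {\<epsilon>. \<exists>k\<ge>m. \<theta> \<le> \<bar>partial_sum x k \<epsilon> - partial_sum x m \<epsilon>\<bar>}
    \<le> ((\<Sum>i. (x i)\<^sup>2) - (\<Sum>i<m. (x i)\<^sup>2)) / \<theta>\<^sup>2"
proof -
  define y where "y = (\<lambda>i. if i < m then 0 else x i)"
  have diff: "partial_sum x k \<epsilon> - partial_sum x m \<epsilon> = partial_sum y k \<epsilon>" if "m \<le> k" for k \<epsilon>
    using that
  proof (induction k rule: dec_induct)
    case base
    then show ?case by (simp add: partial_sum_def y_def)
  next
    case (step k)
    then show ?case by (simp add: partial_sum_Suc y_def)
  qed
  have y_sum: "(\<Sum>i<n. (y i)\<^sup>2) \<le> (\<Sum>i. (x i)\<^sup>2) - (\<Sum>i<m. (x i)\<^sup>2)" for n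
  proof -
    have "(\<Sum>i<n. (y i)\<^sup>2) \<le> (\<Sum>i<m + n. (y i)\<^sup>2)"
      by (rule sum_mono2) auto
    also have "\<dots> = (\<Sum>i<m + n. (x i)\<^sup>2) - (\<Sum>i<m. (x i)\<^sup>2)"
    proof -
      have "(\<Sum>i<m. (y i)\<^sup>2) = 0" by (simp add: y_def)
      moreover have "(\<Sum>i=m..<m + n. (y i)\<^sup>2) = (\<Sum>i=m..<m + n. (x i)\<^sup>2)"
        by (rule sum.cong) (auto simp: y_def)
      moreover have "(\<Sum>i<m + n. f i) = (\<Sum>i<m. f i) + (\<Sum>i=m..<m + n. f i)" for f :: "nat \<Rightarrow> real"
        unfolding lessThan_atLeast0 by (rule sum.atLeastLessThan_concat[symmetric]) auto
      ultimately show ?thesis by simp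
    qed
    also have "(\<Sum>i<m + n. (x i)\<^sup>2) \<le> (\<Sum>i. (x i)\<^sup>2)"
      using x by (intro sum_le_suminf) (auto simp: ell2_def)
    finally show ?thesis by simp
  qed
  let ?E = "\<lambda>n. {\<epsilon>. \<exists>k\<le>n. \<theta> \<le> \<bar>partial_sum y k \<epsilon>\<bar>}"
  have E: "?E n \<in> sets rademacher" for n
  proof -
    have "{\<epsilon> \<in> space rademacher. \<exists>k\<le>n. \<theta> \<le> \<bar>partial_sum y k \<epsilon>\<bar>} \<in> sets rademacher"
      by measurable
    then show ?thesis by simp
  qed
  have inc: "incseq ?E"
    by (auto simp: incseq_def intro: order_trans)
  have lim: "(\<lambda>n. measure rademacher (?E n)) \<longlonglongrightarrow> measure rademacher (\<Union>n. ?E n)"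
    using E inc by (intro rademacher.finite_Lim_measure_incseq) auto
  have "measure rademacher (?E n) \<le> ((\<Sum>i. (x i)\<^sup>2) - (\<Sum>i<m. (x i)\<^sup>2)) / \<theta>\<^sup>2" for n
    by (rule order_trans[OF kolmogorov_maximal_inequality[OF \<open>\<theta> > 0\<close>]])
       (intro divide_right_mono y_sum, simp)
  then have "measure rademacher (\<Union>n. ?E n) \<le> ((\<Sum>i. (x i)\<^sup>2) - (\<Sum>i<m. (x i)\<^sup>2)) / \<theta>\<^sup>2"
    by (intro LIMSEQ_le_const2[OF lim]) auto
  moreover have "measure rademacher {\<epsilon>. \<exists>k\<ge>m. \<theta> \<le> \<bar>partial_sum x k \<epsilon> - partial_sum x m \<epsilon>\<bar>}
      \<le> measure rademacher (\<Union>n. ?E n)"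
  proof (rule rademacher.finite_measure_mono)
    show "(\<Union>n. ?E n) \<in> sets rademacher"
      using E by (intro sets.countable_UN) auto
    show "{\<epsilon>. \<exists>k\<ge>m. \<theta> \<le> \<bar>partial_sum x k \<epsilon> - partial_sum x m \<epsilon>\<bar>} \<subseteq> (\<Union>n. ?E n)"
      using diff by fastforce
  qed
  ultimately show ?thesis by linarith
qed

text \<open>
  For each tolerance \<open>\<theta>\<close>, the event that for every \<open>m\<close> the later partial sums leave the
  \<open>\<theta>\<close>-neighbourhood of the \<open>m\<close>-th one has probability at most \<open>\<theta>\<close> to the power \<open>-2\<close> times any tail of \<open>\<Sum> (x i)\<^sup>2\<close>, hence \<open>0\<close>.  Outside
  countably many such events the partial sums are Cauchy.
\<close>

lemma AE_summable_rademacher: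
  assumes x: "x \<in> ell2"
  shows "AE \<epsilon> in rademacher. summable (\<lambda>i. x i * \<epsilon> i)"
proof -
  have sm: "summable (\<lambda>i. (x i)\<^sup>2)" using x by (simp add: ell2_def)
  have "AE \<epsilon> in rademacher. \<exists>m. \<forall>k\<ge>m. \<bar>partial_sum x k \<epsilon> - partial_sum x m \<epsilon>\<bar> < inverse (real (Suc p))" for p
  proof -
    define \<theta> where "\<theta> = inverse (real (Suc p))"
    have "\<theta> > 0" by (simp add: \<theta>_def)
    let ?B = "\<lambda>m. {\<epsilon>. \<exists>k\<ge>m. \<theta> \<le> \<bar>partial_sum x k \<epsilon> - partial_sum x m \<epsilon>\<bar>}"
    have B: "?B m \<in> sets rademacher" for m
    proof -
      have "{\<epsilon> \<in> space rademacher. \<exists>k\<ge>m. \<theta> \<le> \<bar>partial_sum x k \<epsilon> - partial_sum x m \<epsilon>\<bar>} \<in> sets rademacher"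
        by measurable
      then show ?thesis by simp
    qed
    have I: "(\<Inter>m. ?B m) \<in> sets rademacher"
      using B by (intro sets.countable_INT) auto
    have lim: "(\<lambda>m. ((\<Sum>i. (x i)\<^sup>2) - (\<Sum>i<m. (x i)\<^sup>2)) / \<theta>\<^sup>2) \<longlonglongrightarrow> ((\<Sum>i. (x i)\<^sup>2) - (\<Sum>i. (x i)\<^sup>2)) / \<theta>\<^sup>2"
      using \<open>\<theta> > 0\<close> by (intro tendsto_intros summable_LIMSEQ sm) auto
    have "measure rademacher (\<Inter>m. ?B m) \<le> ((\<Sum>i. (x i)\<^sup>2) - (\<Sum>i<m. (x i)\<^sup>2)) / \<theta>\<^sup>2" for m
      using rademacher.finite_measure_mono[of "\<Inter>m. ?B m" "?B m", OF _ B]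
        tail_exceeds_small[OF x \<open>\<theta> > 0\<close>, of m] by fastforce
    then have "measure rademacher (\<Inter>m. ?B m) \<le> ((\<Sum>i. (x i)\<^sup>2) - (\<Sum>i. (x i)\<^sup>2)) / \<theta>\<^sup>2"
      by (intro LIMSEQ_le_const[OF lim]) auto
    then have "measure rademacher (\<Inter>m. ?B m) = 0"
      by (simp add: measure_le_0_iff)
    then have "(\<Inter>m. ?B m) \<in> null_sets rademacher"
      using I by (simp add: null_sets_def rademacher.emeasure_eq_measure)
    then show ?thesis
      by (rule AE_I') (auto simp: \<theta>_def not_less)
  qed
  then have "AE \<epsilon> in rademacher. \<forall>p. \<exists>m. \<forall>k\<ge>m. \<bar>partial_sum x k \<epsilon> - partial_sum x m \<epsilon>\<bar> < inverse (real (Suc p))"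
    by (simp add: AE_all_countable)
  then show ?thesis
  proof eventually_elim
    case (elim \<epsilon>)
    have "Cauchy (\<lambda>n. partial_sum x n \<epsilon>)"
    proof (rule CauchyI')
      fix e :: real assume "0 < e"
      then obtain p where p: "inverse (real (Suc p)) < e / 2"
        using reals_Archimedean[of "e / 2"] by auto
      obtain m where m: "\<forall>k\<ge>m. \<bar>partial_sum x k \<epsilon> - partial_sum x m \<epsilon>\<bar> < inverse (real (Suc p))"
        using elim by blast
      show "\<exists>M. \<forall>m\<ge>M. \<forall>n>m. dist (partial_sum x m \<epsilon>) (partial_sum x n \<epsilon>) < e"
      proof (intro exI[of _ m] allI impI)
        fix k n assume "m \<le> k" "k < n"
        then show "dist (partial_sum x k \<epsilon>) (partial_sum x n \<epsilon>) < e"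
          using m[rule_format, of k] m[rule_format, of n] p by (auto simp: dist_real_def abs_if split: if_splits)
      qed
    qed
    then show ?case
      by (simp add: summable_iff_convergent Cauchy_convergent_iff partial_sum_def)
  qed
qed

section \<open>Moments of Bernoulli series\<close>

lemma ell2_diff:
  assumes "x \<in> ell2" "y \<in> ell2"
  shows "(\<lambda>i. x i - y i) \<in> ell2"
proof -
  have "summable (\<lambda>i. 2 * (x i)\<^sup>2 + 2 * (y i)\<^sup>2)"
    using assms by (simp add: ell2_def summable_add summable_mult)
  moreover have "norm ((x i - y i)\<^sup>2) \<le> 2 * (x i)\<^sup>2 + 2 * (y i)\<^sup>2" for i
  proof -
    have "(x i - y i)\<^sup>2 = (x i)\<^sup>2 - 2 * x i * y i + (y i)\<^sup>2"
      by (rule power2_diff[THEN trans]) simp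
    moreover have "- (2 * x i * y i) \<le> (x i)\<^sup>2 + (y i)\<^sup>2"
      using sum_squares_bound[of "x i" "- y i"] by simp
    moreover have "norm ((x i - y i)\<^sup>2) = (x i - y i)\<^sup>2" by simp
    ultimately show ?thesis by linarith
  qed
  ultimately have "summable (\<lambda>i. (x i - y i)\<^sup>2)"
    by (rule summable_comparison_test'[where N=0])
  then show ?thesis
    unfolding ell2_def by simp
qed

lemma ell2_dominated:
  assumes "x \<in> ell2" "\<And>i. \<bar>y i\<bar> \<le> \<bar>x i\<bar>"
  shows "y \<in> ell2"
  using assms unfolding ell2_def
  by (auto intro!: summable_comparison_test'[where N=0 and g="\<lambda>i. (x i)\<^sup>2"] simp: abs_le_square_iff)

lemma ell2_tail_tendsto_0:
  assumes "x \<in> ell2"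
  shows "(\<lambda>n. \<Sum>i. (if i < n then 0 else x i)\<^sup>2) \<longlonglongrightarrow> 0"
proof -
  have sm: "summable (\<lambda>i. (x i)\<^sup>2)" using assms by (simp add: ell2_def)
  have "(\<Sum>i. (if i < n then 0 else x i)\<^sup>2) = (\<Sum>i. (x i)\<^sup>2) - (\<Sum>i<n. (x i)\<^sup>2)" for n
  proof -
    have "(\<lambda>i. if i < n then (x i)\<^sup>2 else 0) sums (\<Sum>i | i < n. (x i)\<^sup>2)"
      by (rule sums_If_finite) simp
    from sums_diff[OF summable_sums[OF sm] this]
    have "(\<lambda>i. (x i)\<^sup>2 - (if i < n then (x i)\<^sup>2 else 0)) sums ((\<Sum>i. (x i)\<^sup>2) - (\<Sum>i<n. (x i)\<^sup>2))"
      by (simp add: lessThan_def)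
    moreover have "(x i)\<^sup>2 - (if i < n then (x i)\<^sup>2 else 0) = (if i < n then 0 else x i)\<^sup>2" for i
      by simp
    ultimately show ?thesis by (simp only: sums_iff)
  qed
  moreover have "(\<lambda>n. (\<Sum>i. (x i)\<^sup>2) - (\<Sum>i<n. (x i)\<^sup>2)) \<longlonglongrightarrow> (\<Sum>i. (x i)\<^sup>2) - (\<Sum>i. (x i)\<^sup>2)"
    by (intro tendsto_diff tendsto_const summable_LIMSEQ sm)
  ultimately show ?thesis by (simp only: diff_self)
qed

lemma measurable_bernoulli_sum [measurable]: "bernoulli_sum x \<in> borel_measurable rademacher"
  unfolding bernoulli_sum_def by measurable

lemma integral_partial_sum_square:
  "(\<integral>\<epsilon>. (partial_sum x n \<epsilon>)\<^sup>2 \<partial>rademacher) = (\<Sum>i<n. (x i)\<^sup>2)"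
proof (induction n)
  case (Suc n)
  let ?P = "partial_sum x n"
  have eq: "AE \<epsilon> in rademacher.
      (partial_sum x (Suc n) \<epsilon>)\<^sup>2 = (?P \<epsilon>)\<^sup>2 + (2 * x n * ?P \<epsilon>) * \<epsilon> n + (x n)\<^sup>2"
    using AE_coordinate
  proof eventually_elim
    case (elim \<epsilon>)
    have "(\<epsilon> n)\<^sup>2 = 1" using elim by (metis power2_abs one_power2)
    then show ?case by (simp add: partial_sum_Suc power2_sum power_mult_distrib algebra_simps)
  qed
  have i: "integrable rademacher (\<lambda>\<epsilon>. (2 * x n * ?P \<epsilon>) * \<epsilon> n)"
  proof -
    have "integrable rademacher (\<lambda>\<epsilon>. (partial_sum x (Suc n) \<epsilon>)\<^sup>2 - (?P \<epsilon>)\<^sup>2 - (x n)\<^sup>2)"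
      by (intro Bochner_Integration.integrable_diff integrable_partial_sum_power) simp
    then show ?thesis
    proof (rule integrable_cong_AE_imp)
      show "AE \<epsilon> in rademacher. (partial_sum x (Suc n) \<epsilon>)\<^sup>2 - (?P \<epsilon>)\<^sup>2 - (x n)\<^sup>2 = (2 * x n * ?P \<epsilon>) * \<epsilon> n"
        using eq by eventually_elim simp
    qed measurable
  qed
  have "(\<integral>\<epsilon>. (partial_sum x (Suc n) \<epsilon>)\<^sup>2 \<partial>rademacher)
      = (\<integral>\<epsilon>. (?P \<epsilon>)\<^sup>2 + (2 * x n * ?P \<epsilon>) * \<epsilon> n + (x n)\<^sup>2 \<partial>rademacher)"
    by (rule integral_cong_AE[OF _ _ eq]) measurable
  also have "\<dots> = (\<integral>\<epsilon>. (?P \<epsilon>)\<^sup>2 \<partial>rademacher)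
      + (\<integral>\<epsilon>. (2 * x n * ?P \<epsilon>) * \<epsilon> n \<partial>rademacher) + (x n)\<^sup>2"
    using i integrable_partial_sum_power[of x n 2]
    by (simp add: rademacher.prob_space[unfolded space_rademacher])
  also have "(\<integral>\<epsilon>. (2 * x n * ?P \<epsilon>) * \<epsilon> n \<partial>rademacher) = 0"
    by (rule integral_odd_coordinate) (measurable, simp add: partial_sum_flip)
  finally show ?case using Suc by simp
qed (simp add: partial_sum_def)

lemma sign_power4:
  fixes p c q :: real
  assumes "q\<^sup>2 = 1"
  shows "(p + c * q) ^ 4 = p ^ 4 + (4 * c * p ^ 3 + 4 * c ^ 3 * p) * q + 6 * c\<^sup>2 * p\<^sup>2 + c ^ 4"
proof -
  have sq: "(u + v * q)\<^sup>2 = u\<^sup>2 + v\<^sup>2 + (2 * u * v) * q" for u v :: real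
    using assms by (simp add: power2_sum power_mult_distrib)
  have "(p + c * q) ^ 4 = ((p + c * q)\<^sup>2)\<^sup>2"
    by (simp flip: power_mult)
  also have "\<dots> = (p\<^sup>2 + c\<^sup>2)\<^sup>2 + (2 * p * c)\<^sup>2 + (2 * (p\<^sup>2 + c\<^sup>2) * (2 * p * c)) * q"
    by (simp only: sq)
  also have "\<dots> = p ^ 4 + (4 * c * p ^ 3 + 4 * c ^ 3 * p) * q + 6 * c\<^sup>2 * p\<^sup>2 + c ^ 4"
    by (simp add: power2_eq_square power3_eq_cube power4_eq_xxxx distrib_left distrib_right mult_ac)
  finally show ?thesis .
qed

text \<open>
  The odd powers of the new sign integrate to zero, which leaves the recursion
  \<open>E (P + c \<epsilon>)\<^sup>4 = E P\<^sup>4 + 6 c\<^sup>2 E P\<^sup>2 + c\<^sup>4\<close>; the constant \<open>3\<close> is what makes it close.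
\<close>

lemma integral_partial_sum_power4:
  "(\<integral>\<epsilon>. (partial_sum x n \<epsilon>) ^ 4 \<partial>rademacher) \<le> 3 * (\<Sum>i<n. (x i)\<^sup>2)\<^sup>2"
proof (induction n)
  case (Suc n)
  let ?P = "partial_sum x n" and ?s = "\<Sum>i<n. (x i)\<^sup>2"
  let ?odd = "\<lambda>\<epsilon>. (4 * x n * ?P \<epsilon> ^ 3 + 4 * x n ^ 3 * ?P \<epsilon>) * \<epsilon> n"
  have eq: "AE \<epsilon> in rademacher.
      (partial_sum x (Suc n) \<epsilon>) ^ 4 = ?P \<epsilon> ^ 4 + ?odd \<epsilon> + 6 * (x n)\<^sup>2 * (?P \<epsilon>)\<^sup>2 + x n ^ 4"
    using AE_coordinate
  proof eventually_elim
    case (elim \<epsilon>)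
    have e: "(\<epsilon> n)\<^sup>2 = 1" using elim by (metis power2_abs one_power2)
    from sign_power4[OF e, of "?P \<epsilon>" "x n"] show ?case
      by (simp only: partial_sum_Suc)
  qed
  have i: "integrable rademacher ?odd"
  proof -
    have "integrable rademacher
        (\<lambda>\<epsilon>. (partial_sum x (Suc n) \<epsilon>) ^ 4 - ?P \<epsilon> ^ 4 - 6 * (x n)\<^sup>2 * (?P \<epsilon>)\<^sup>2 - x n ^ 4)"
      by (intro Bochner_Integration.integrable_diff integrable_mult_right integrable_partial_sum_power) simp
    then show ?thesis
    proof (rule integrable_cong_AE_imp)
      show "AE \<epsilon> in rademacher. (partial_sum x (Suc n) \<epsilon>) ^ 4 - ?P \<epsilon> ^ 4 - 6 * (x n)\<^sup>2 * (?P \<epsilon>)\<^sup>2 - x n ^ 4 = ?odd \<epsilon>"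
        using eq by eventually_elim simp
    qed measurable
  qed
  have "(\<integral>\<epsilon>. (partial_sum x (Suc n) \<epsilon>) ^ 4 \<partial>rademacher)
      = (\<integral>\<epsilon>. ?P \<epsilon> ^ 4 + ?odd \<epsilon> + 6 * (x n)\<^sup>2 * (?P \<epsilon>)\<^sup>2 + x n ^ 4 \<partial>rademacher)"
    by (rule integral_cong_AE[OF _ _ eq]) measurable
  also have "\<dots> = (\<integral>\<epsilon>. ?P \<epsilon> ^ 4 \<partial>rademacher) + (\<integral>\<epsilon>. ?odd \<epsilon> \<partial>rademacher)
      + 6 * (x n)\<^sup>2 * ?s + x n ^ 4"
    using i integrable_partial_sum_power[of x n 2] integrable_partial_sum_power[of x n 4]
    by (simp add: rademacher.prob_space[unfolded space_rademacher] integral_partial_sum_square)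
  also have "(\<integral>\<epsilon>. ?odd \<epsilon> \<partial>rademacher) = 0"
    by (rule integral_odd_coordinate) (measurable, simp add: partial_sum_flip)
  also have "(\<integral>\<epsilon>. ?P \<epsilon> ^ 4 \<partial>rademacher) + 0 + 6 * (x n)\<^sup>2 * ?s + x n ^ 4
      \<le> 3 * ?s\<^sup>2 + 6 * (x n)\<^sup>2 * ?s + 3 * x n ^ 4"
  proof -
    have "0 \<le> x n ^ 4" by simp
    then show ?thesis using Suc by linarith
  qed
  also have "\<dots> = 3 * (\<Sum>i<Suc n. (x i)\<^sup>2)\<^sup>2"
    by (simp add: power2_sum algebra_simps power4_eq_xxxx power2_eq_square)
  finally show ?case .
qed (simp add: partial_sum_def)

text \<open>
  Fatou's lemma along the almost surely convergent partial sums.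
\<close>

lemma bernoulli_sum_second_moment:
  assumes x: "x \<in> ell2"
  shows "integrable rademacher (\<lambda>\<epsilon>. (bernoulli_sum x \<epsilon>)\<^sup>2)"
    and "(\<integral>\<epsilon>. (bernoulli_sum x \<epsilon>)\<^sup>2 \<partial>rademacher) \<le> (\<Sum>i. (x i)\<^sup>2)"
proof -
  have sm: "summable (\<lambda>i. (x i)\<^sup>2)" using x by (simp add: ell2_def)
  have "(\<integral>\<^sup>+\<epsilon>. ennreal ((bernoulli_sum x \<epsilon>)\<^sup>2) \<partial>rademacher)
      = (\<integral>\<^sup>+\<epsilon>. liminf (\<lambda>n. ennreal ((partial_sum x n \<epsilon>)\<^sup>2)) \<partial>rademacher)"
  proof (rule nn_integral_cong_AE)
    show "AE \<epsilon> in rademacher.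
        ennreal ((bernoulli_sum x \<epsilon>)\<^sup>2) = liminf (\<lambda>n. ennreal ((partial_sum x n \<epsilon>)\<^sup>2))"
      using AE_summable_rademacher[OF x]
    proof eventually_elim
      case (elim \<epsilon>)
      have "(\<lambda>n. partial_sum x n \<epsilon>) \<longlonglongrightarrow> bernoulli_sum x \<epsilon>"
        unfolding partial_sum_def bernoulli_sum_def by (rule summable_LIMSEQ[OF elim])
      then have "(\<lambda>n. ennreal ((partial_sum x n \<epsilon>)\<^sup>2)) \<longlonglongrightarrow> ennreal ((bernoulli_sum x \<epsilon>)\<^sup>2)"
        by (intro tendsto_ennrealI tendsto_intros)
      then show ?case by (rule lim_imp_Liminf[symmetric, rotated]) simp
    qed
  qed
  also have "\<dots> \<le> liminf (\<lambda>n. \<integral>\<^sup>+\<epsilon>. ennreal ((partial_sum x n \<epsilon>)\<^sup>2) \<partial>rademacher)"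
    by (rule nn_integral_liminf) measurable
  also have "\<dots> \<le> liminf (\<lambda>n. ennreal (\<Sum>i. (x i)\<^sup>2))"
  proof (intro Liminf_mono always_eventually allI)
    fix n
    have "(\<integral>\<^sup>+\<epsilon>. ennreal ((partial_sum x n \<epsilon>)\<^sup>2) \<partial>rademacher) = ennreal (\<Sum>i<n. (x i)\<^sup>2)"
      by (subst nn_integral_eq_integral[OF integrable_partial_sum_power])
         (auto simp: integral_partial_sum_square)
    also have "\<dots> \<le> ennreal (\<Sum>i. (x i)\<^sup>2)"
      by (intro ennreal_leI sum_le_suminf[OF sm]) auto
    finally show "(\<integral>\<^sup>+\<epsilon>. ennreal ((partial_sum x n \<epsilon>)\<^sup>2) \<partial>rademacher) \<le> ennreal (\<Sum>i. (x i)\<^sup>2)" .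
  qed
  finally have le: "(\<integral>\<^sup>+\<epsilon>. ennreal ((bernoulli_sum x \<epsilon>)\<^sup>2) \<partial>rademacher) \<le> ennreal (\<Sum>i. (x i)\<^sup>2)"
    by (simp add: Liminf_const)
  show int: "integrable rademacher (\<lambda>\<epsilon>. (bernoulli_sum x \<epsilon>)\<^sup>2)"
  proof (rule integrableI_bounded)
    show "(\<integral>\<^sup>+\<epsilon>. ennreal (norm ((bernoulli_sum x \<epsilon>)\<^sup>2)) \<partial>rademacher) < \<infinity>"
      using le_less_trans[OF le] by simp
  qed measurable
  from le show "(\<integral>\<epsilon>. (bernoulli_sum x \<epsilon>)\<^sup>2 \<partial>rademacher) \<le> (\<Sum>i. (x i)\<^sup>2)"
    by (subst (asm) nn_integral_eq_integral[OF int]) (auto simp: suminf_nonneg[OF sm])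
qed

lemma integrable_bernoulli_sum [simp]:
  "x \<in> ell2 \<Longrightarrow> integrable rademacher (bernoulli_sum x)"
  by (rule rademacher.square_integrable_imp_integrable[OF measurable_bernoulli_sum bernoulli_sum_second_moment(1)])

lemma integral_abs_bernoulli_sum_le:
  assumes x: "x \<in> ell2"
  shows "(\<integral>\<epsilon>. \<bar>bernoulli_sum x \<epsilon>\<bar> \<partial>rademacher) \<le> sqrt (\<Sum>i. (x i)\<^sup>2)"
proof (rule real_le_rsqrt)
  have i: "integrable rademacher (\<lambda>\<epsilon>. \<bar>bernoulli_sum x \<epsilon>\<bar>)" using x by simp
  have "0 \<le> rademacher.variance (\<lambda>\<epsilon>. \<bar>bernoulli_sum x \<epsilon>\<bar>)"
    by (rule rademacher.variance_positive)
  also have "\<dots> = (\<integral>\<epsilon>. (bernoulli_sum x \<epsilon>)\<^sup>2 \<partial>rademacher) - (\<integral>\<epsilon>. \<bar>bernoulli_sum x \<epsilon>\<bar> \<partial>rademacher)\<^sup>2"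
    using rademacher.variance_eq[OF i] bernoulli_sum_second_moment(1)[OF x] by simp
  finally show "(\<integral>\<epsilon>. \<bar>bernoulli_sum x \<epsilon>\<bar> \<partial>rademacher)\<^sup>2 \<le> (\<Sum>i. (x i)\<^sup>2)"
    using bernoulli_sum_second_moment(2)[OF x] by linarith
qed

lemma AE_bernoulli_sum_diff:
  assumes "x \<in> ell2" "y \<in> ell2"
  shows "AE \<epsilon> in rademacher.
    bernoulli_sum x \<epsilon> - bernoulli_sum y \<epsilon> = bernoulli_sum (\<lambda>i. x i - y i) \<epsilon>"
  using AE_summable_rademacher[OF assms(1)] AE_summable_rademacher[OF assms(2)]
  by eventually_elim (simp add: bernoulli_sum_def suminf_diff left_diff_distrib)

lemma bernoulli_sum_L1_dist:
  assumes x: "x \<in> ell2" and y: "y \<in> ell2"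
  shows "(\<integral>\<epsilon>. \<bar>bernoulli_sum x \<epsilon> - bernoulli_sum y \<epsilon>\<bar> \<partial>rademacher) \<le> sqrt (\<Sum>i. (x i - y i)\<^sup>2)"
proof -
  have "(\<integral>\<epsilon>. \<bar>bernoulli_sum x \<epsilon> - bernoulli_sum y \<epsilon>\<bar> \<partial>rademacher)
      = (\<integral>\<epsilon>. \<bar>bernoulli_sum (\<lambda>i. x i - y i) \<epsilon>\<bar> \<partial>rademacher)"
    by (rule integral_cong_AE) (use AE_bernoulli_sum_diff[OF x y] in auto)
  then show ?thesis
    using integral_abs_bernoulli_sum_le[OF ell2_diff[OF x y]] by simp
qed

lemma partial_sum_L1_tendsto:
  assumes x: "x \<in> ell2"
  shows "(\<lambda>n. \<integral>\<epsilon>. \<bar>bernoulli_sum x \<epsilon> - partial_sum x n \<epsilon>\<bar> \<partial>rademacher) \<longlonglongrightarrow> 0"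
proof (rule tendsto_sandwich[OF _ _ tendsto_const])
  show "(\<lambda>n. sqrt (\<Sum>i. (if i < n then 0 else x i)\<^sup>2)) \<longlonglongrightarrow> 0"
    using tendsto_real_sqrt[OF ell2_tail_tendsto_0[OF x]] by simp
  have "(\<integral>\<epsilon>. \<bar>bernoulli_sum x \<epsilon> - partial_sum x n \<epsilon>\<bar> \<partial>rademacher)
      \<le> sqrt (\<Sum>i. (if i < n then 0 else x i)\<^sup>2)" for n
  proof -
    let ?y = "\<lambda>i. if i < n then x i else 0"
    have y: "?y \<in> ell2" by (rule ell2_dominated[OF x]) auto
    have "bernoulli_sum ?y \<epsilon> = partial_sum x n \<epsilon>" for \<epsilon>
      unfolding bernoulli_sum_def partial_sum_def
      by (subst suminf_finite[of "{..<n}"]) auto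
    moreover have "(\<lambda>i. (x i - ?y i)\<^sup>2) = (\<lambda>i. (if i < n then 0 else x i)\<^sup>2)" by auto
    ultimately show ?thesis using bernoulli_sum_L1_dist[OF x y] by simp
  qed
  then show "\<forall>\<^sub>F n in sequentially. (\<integral>\<epsilon>. \<bar>bernoulli_sum x \<epsilon> - partial_sum x n \<epsilon>\<bar> \<partial>rademacher)
      \<le> sqrt (\<Sum>i. (if i < n then 0 else x i)\<^sup>2)" by simp
qed (simp add: always_eventually)

lemma integral_bernoulli_sum:
  assumes x: "x \<in> ell2"
  shows "(\<integral>\<epsilon>. bernoulli_sum x \<epsilon> \<partial>rademacher) = 0"
proof -
  have "\<bar>\<integral>\<epsilon>. bernoulli_sum x \<epsilon> \<partial>rademacher\<bar>
      \<le> (\<integral>\<epsilon>. \<bar>bernoulli_sum x \<epsilon> - partial_sum x n \<epsilon>\<bar> \<partial>rademacher)" for n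
  proof -
    have i: "integrable rademacher (partial_sum x n)"
      using integrable_partial_sum_power[of x n 1] by simp
    have "(\<integral>\<epsilon>. bernoulli_sum x \<epsilon> - partial_sum x n \<epsilon> \<partial>rademacher) = (\<integral>\<epsilon>. bernoulli_sum x \<epsilon> \<partial>rademacher)"
      using x i by (simp add: integral_partial_sum)
    then show ?thesis
      using integral_abs_bound[of rademacher "\<lambda>\<epsilon>. bernoulli_sum x \<epsilon> - partial_sum x n \<epsilon>"] by simp
  qed
  then have "\<bar>\<integral>\<epsilon>. bernoulli_sum x \<epsilon> \<partial>rademacher\<bar> \<le> 0"
    by (intro LIMSEQ_le_const[OF partial_sum_L1_tendsto[OF x]]) auto
  then show ?thesis by simp
qed

text \<open>
  With \<open>s\<close> the standard deviation and \<open>a = \<bar>y\<bar> / s\<close>, the elementary bound \<open>a \<ge> a\<^sup>2 - a\<^sup>4 / 4\<close> converts the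
  second and fourth moments into a lower bound \<open>1 - 3 / 4\<close> for the first absolute moment.
\<close>

lemma khintchine_partial_sum:
  "sqrt (\<Sum>i<n. (x i)\<^sup>2) / 4 \<le> (\<integral>\<epsilon>. \<bar>partial_sum x n \<epsilon>\<bar> \<partial>rademacher)"
proof (cases "(\<Sum>i<n. (x i)\<^sup>2) = 0")
  case False
  define s where "s = sqrt (\<Sum>i<n. (x i)\<^sup>2)"
  have nn: "0 \<le> (\<Sum>i<n. (x i)\<^sup>2)" by (simp add: sum_nonneg)
  have s: "s > 0" "s\<^sup>2 = (\<Sum>i<n. (x i)\<^sup>2)"
    using False nn by (auto simp: s_def)
  have key: "y\<^sup>2 / s - y ^ 4 / (4 * s ^ 3) \<le> \<bar>y\<bar>" for y :: real
  proof -
    define a where "a = \<bar>y\<bar> / s"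
    have a: "0 \<le> a" "\<bar>y\<bar> = a * s" using s(1) by (auto simp: a_def)
    have "0 \<le> a * (1 - a + a ^ 3 / 4)"
    proof (intro mult_nonneg_nonneg a(1))
      \<comment> \<open>\<open>a ^ 3\<close> lies above its tangent at \<open>6 / 5\<close>, a rational close to the minimiser of \<open>1 - a + a ^ 3 / 4\<close>.\<close>
      have "0 \<le> (a - 6 / 5)\<^sup>2 * (a + 12 / 5)" using a by simp
      also have "\<dots> = a ^ 3 - 108 / 25 * a + 432 / 125"
        by (simp add: power2_eq_square power3_eq_cube field_simps)
      finally show "0 \<le> 1 - a + a ^ 3 / 4" using a(1) by linarith
    qed
    then have "a\<^sup>2 - a ^ 4 / 4 \<le> a"
      by (simp add: power2_eq_square power3_eq_cube power4_eq_xxxx algebra_simps)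
    then have "s * (a\<^sup>2 - a ^ 4 / 4) \<le> s * a"
      using s(1) by simp
    moreover have "y\<^sup>2 / s = s * a\<^sup>2"
    proof -
      have "y\<^sup>2 = (a * s)\<^sup>2" using a(2) by (metis power2_abs)
      then show ?thesis using s(1) by (simp add: power2_eq_square)
    qed
    moreover have "y ^ 4 / (4 * s ^ 3) = s * (a ^ 4 / 4)"
    proof -
      have "y ^ 4 = (a * s) ^ 4" using a(2) by (metis power_even_abs_numeral even_numeral)
      then show ?thesis using s(1) by (simp add: power3_eq_cube power4_eq_xxxx)
    qed
    ultimately show ?thesis
      using a(2) by (simp add: algebra_simps)
  qed
  have "s / 4 = s\<^sup>2 / s - 3 * (s\<^sup>2)\<^sup>2 / (4 * s ^ 3)"
    using s(1) by (simp add: field_simps power2_eq_square power3_eq_cube)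
  also have "\<dots> \<le> (\<integral>\<epsilon>. (partial_sum x n \<epsilon>)\<^sup>2 \<partial>rademacher) / s
      - (\<integral>\<epsilon>. partial_sum x n \<epsilon> ^ 4 \<partial>rademacher) / (4 * s ^ 3)"
    using integral_partial_sum_power4[of x n] s
    by (auto simp: integral_partial_sum_square intro!: divide_right_mono)
  also have "\<dots> = (\<integral>\<epsilon>. (partial_sum x n \<epsilon>)\<^sup>2 / s - partial_sum x n \<epsilon> ^ 4 / (4 * s ^ 3) \<partial>rademacher)"
    using integrable_partial_sum_power[of x n] by simp
  also have "\<dots> \<le> (\<integral>\<epsilon>. \<bar>partial_sum x n \<epsilon>\<bar> \<partial>rademacher)"
    using integrable_partial_sum_power[of x n] integrable_partial_sum_power[of x n 1]
    by (intro integral_mono key) auto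
  finally show ?thesis by (simp add: s_def)
qed simp

lemma khintchine:
  assumes x: "x \<in> ell2"
  shows "sqrt (\<Sum>i. (x i)\<^sup>2) / 4 \<le> (\<integral>\<epsilon>. \<bar>bernoulli_sum x \<epsilon>\<bar> \<partial>rademacher)"
proof -
  have sm: "summable (\<lambda>i. (x i)\<^sup>2)" using x by (simp add: ell2_def)
  let ?e = "\<lambda>n. \<integral>\<epsilon>. \<bar>bernoulli_sum x \<epsilon> - partial_sum x n \<epsilon>\<bar> \<partial>rademacher"
  have "sqrt (\<Sum>i<n. (x i)\<^sup>2) / 4 - ?e n \<le> (\<integral>\<epsilon>. \<bar>bernoulli_sum x \<epsilon>\<bar> \<partial>rademacher)" for n
  proof -
    have i: "integrable rademacher (partial_sum x n)"
      using integrable_partial_sum_power[of x n 1] by simp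
    have "(\<integral>\<epsilon>. \<bar>partial_sum x n \<epsilon>\<bar> \<partial>rademacher)
        \<le> (\<integral>\<epsilon>. \<bar>bernoulli_sum x \<epsilon>\<bar> + \<bar>bernoulli_sum x \<epsilon> - partial_sum x n \<epsilon>\<bar> \<partial>rademacher)"
      using x i by (intro integral_mono) auto
    also have "\<dots> = (\<integral>\<epsilon>. \<bar>bernoulli_sum x \<epsilon>\<bar> \<partial>rademacher) + ?e n"
      using x i by simp
    finally show ?thesis using khintchine_partial_sum[of x n] by linarith
  qed
  moreover have "(\<lambda>n. sqrt (\<Sum>i<n. (x i)\<^sup>2) / 4 - ?e n) \<longlonglongrightarrow> sqrt (\<Sum>i. (x i)\<^sup>2) / 4 - 0"
    by (intro tendsto_intros summable_LIMSEQ sm partial_sum_L1_tendsto x) auto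
  ultimately show ?thesis
    by (intro LIMSEQ_le_const2[where X="\<lambda>n. sqrt (\<Sum>i<n. (x i)\<^sup>2) / 4 - ?e n"]) auto
qed

section \<open>Contraction principle for Bernoulli suprema\<close>

definition expected_max :: "('a \<Rightarrow> nat \<Rightarrow> real) \<Rightarrow> 'a set \<Rightarrow> real" where
  "expected_max z S = (\<integral>\<epsilon>. Max ((\<lambda>t. bernoulli_sum (z t) \<epsilon>) ` S) \<partial>rademacher)"

lemma bernoulli_sup_eq_SUP_expected_max:
  "bernoulli_sup z D = (SUP S \<in> {S. S \<subseteq> D \<and> finite S \<and> S \<noteq> {}}. ereal (expected_max z S))"
  by (simp add: bernoulli_sup_def expected_max_def)

lemma Max_image_attained:
  assumes "finite S" "S \<noteq> {}"
  obtains t where "t \<in> S" "Max (f ` S) = f t"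
proof -
  have "Max (f ` S) \<in> f ` S" using assms by (intro Max_in) auto
  then show ?thesis using that by (rule imageE) simp
qed

lemma abs_Max_image_diff_le:
  fixes f g :: "'a \<Rightarrow> real"
  assumes S: "finite S" "S \<noteq> {}"
  shows "\<bar>Max (f ` S) - Max (g ` S)\<bar> \<le> (\<Sum>t\<in>S. \<bar>f t - g t\<bar>)"
proof -
  have *: "Max (f ` S) \<le> Max (g ` S) + (\<Sum>t\<in>S. \<bar>f t - g t\<bar>)" for f g :: "'a \<Rightarrow> real"
  proof -
    obtain t where t: "t \<in> S" "Max (f ` S) = f t"
      using Max_image_attained[OF S] .
    have "g t \<le> Max (g ` S)" using S t by simp
    moreover have "\<bar>f t - g t\<bar> \<le> (\<Sum>t\<in>S. \<bar>f t - g t\<bar>)"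
      using S t by (intro member_le_sum) auto
    ultimately show ?thesis using t by linarith
  qed
  show ?thesis
    using *[of f g] *[of g f] by (simp add: abs_le_iff abs_minus_commute)
qed

lemma measurable_Max_bernoulli_sum [measurable]:
  "finite S \<Longrightarrow> (\<lambda>\<epsilon>. Max ((\<lambda>t. bernoulli_sum (z t) \<epsilon>) ` S)) \<in> borel_measurable rademacher"
  by (rule borel_measurable_Max) measurable

lemma integrable_Max_bernoulli_sum:
  assumes S: "finite S" "S \<noteq> {}" and z: "\<And>t. t \<in> S \<Longrightarrow> z t \<in> ell2"
  shows "integrable rademacher (\<lambda>\<epsilon>. Max ((\<lambda>t. bernoulli_sum (z t) \<epsilon>) ` S))"
proof (rule Bochner_Integration.integrable_bound)
  show "integrable rademacher (\<lambda>\<epsilon>. \<Sum>t\<in>S. \<bar>bernoulli_sum (z t) \<epsilon>\<bar>)"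
    using z by (intro Bochner_Integration.integrable_sum integrable_abs) auto
  show "AE \<epsilon> in rademacher. norm (Max ((\<lambda>t. bernoulli_sum (z t) \<epsilon>) ` S))
      \<le> norm (\<Sum>t\<in>S. \<bar>bernoulli_sum (z t) \<epsilon>\<bar>)"
  proof (rule AE_I2)
    fix \<epsilon>
    have "Max ((\<lambda>t. 0::real) ` S) = 0" using S by (simp add: image_constant_conv)
    then show "norm (Max ((\<lambda>t. bernoulli_sum (z t) \<epsilon>) ` S)) \<le> norm (\<Sum>t\<in>S. \<bar>bernoulli_sum (z t) \<epsilon>\<bar>)"
      using abs_Max_image_diff_le[OF S, of "\<lambda>t. bernoulli_sum (z t) \<epsilon>" "\<lambda>_. 0"]
      by (simp add: sum_nonneg)
  qed
qed (use S in measurable)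

text \<open>
  A maximum over \<open>S\<close> changes by at most the sum of the changes of its entries, and each entry
  changes in \<open>L\<^sup>1\<close> by at most the \<open>\<ell>\<^sup>2\<close> distance of the coefficient vectors.
\<close>

lemma expected_max_tendsto:
  assumes S: "finite S" "S \<noteq> {}"
    and z: "\<And>n t. t \<in> S \<Longrightarrow> z n t \<in> ell2" and y: "\<And>t. t \<in> S \<Longrightarrow> y t \<in> ell2"
    and lim: "\<And>t. t \<in> S \<Longrightarrow> (\<lambda>n. \<Sum>i. (z n t i - y t i)\<^sup>2) \<longlonglongrightarrow> 0"
  shows "(\<lambda>n. expected_max (z n) S) \<longlonglongrightarrow> expected_max y S"
proof (rule LIM_zero_cancel, rule tendsto_rabs_zero_cancel, rule tendsto_sandwich[OF _ _ tendsto_const])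
  show "(\<lambda>n. \<Sum>t\<in>S. sqrt (\<Sum>i. (z n t i - y t i)\<^sup>2)) \<longlonglongrightarrow> 0"
    by (rule tendsto_eq_intros refl tendsto_real_sqrt lim | assumption)+ (simp add: S)
  have "\<bar>expected_max (z n) S - expected_max y S\<bar> \<le> (\<Sum>t\<in>S. sqrt (\<Sum>i. (z n t i - y t i)\<^sup>2))" for n
  proof -
    let ?f = "\<lambda>t. bernoulli_sum (z n t)" and ?g = "\<lambda>t. bernoulli_sum (y t)"
    have if': "integrable rademacher (\<lambda>\<epsilon>. Max ((\<lambda>t. ?f t \<epsilon>) ` S))"
      and ig: "integrable rademacher (\<lambda>\<epsilon>. Max ((\<lambda>t. ?g t \<epsilon>) ` S))"
      using S z y by (auto intro!: integrable_Max_bernoulli_sum)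
    have "\<bar>expected_max (z n) S - expected_max y S\<bar>
        = \<bar>\<integral>\<epsilon>. Max ((\<lambda>t. ?f t \<epsilon>) ` S) - Max ((\<lambda>t. ?g t \<epsilon>) ` S) \<partial>rademacher\<bar>"
      using if' ig by (simp add: expected_max_def)
    also have "\<dots> \<le> (\<integral>\<epsilon>. \<bar>Max ((\<lambda>t. ?f t \<epsilon>) ` S) - Max ((\<lambda>t. ?g t \<epsilon>) ` S)\<bar> \<partial>rademacher)"
      by (rule integral_abs_bound)
    also have "\<dots> \<le> (\<integral>\<epsilon>. (\<Sum>t\<in>S. \<bar>?f t \<epsilon> - ?g t \<epsilon>\<bar>) \<partial>rademacher)"
      using if' ig z y
      by (intro integral_mono abs_Max_image_diff_le S integrable_abs Bochner_Integration.integrable_sum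
          Bochner_Integration.integrable_diff integrable_bernoulli_sum)
    also have "\<dots> = (\<Sum>t\<in>S. \<integral>\<epsilon>. \<bar>?f t \<epsilon> - ?g t \<epsilon>\<bar> \<partial>rademacher)"
      using z y by (intro Bochner_Integration.integral_sum integrable_abs
          Bochner_Integration.integrable_diff integrable_bernoulli_sum)
    also have "\<dots> \<le> (\<Sum>t\<in>S. sqrt (\<Sum>i. (z n t i - y t i)\<^sup>2))"
      using z y by (intro sum_mono bernoulli_sum_L1_dist)
    finally show ?thesis .
  qed
  then show "\<forall>\<^sub>F n in sequentially. \<bar>expected_max (z n) S - expected_max y S\<bar>
      \<le> (\<Sum>t\<in>S. sqrt (\<Sum>i. (z n t i - y t i)\<^sup>2))" by simp
qed simp

text \<open>
  Let \<open>s\<close> and \<open>t\<close> attain the two maxima on the left.  Their sum contains \<open>(g s - g t) \<sigma>\<close>, which is at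
  most \<open>\<bar>f s - f t\<bar>\<close>; depending on the sign of \<open>(f s - f t) \<sigma>\<close>, testing the maxima on the right at
  \<open>s, t\<close> or at \<open>t, s\<close> recovers this much.
\<close>

lemma Max_sign_contraction:
  fixes a f g :: "'a \<Rightarrow> real"
  assumes S: "finite S" "S \<noteq> {}" and \<sigma>: "\<bar>\<sigma>\<bar> = 1"
    and le: "\<And>s t. s \<in> S \<Longrightarrow> t \<in> S \<Longrightarrow> \<bar>g s - g t\<bar> \<le> \<bar>f s - f t\<bar>"
  shows "Max ((\<lambda>t. a t + g t * \<sigma>) ` S) + Max ((\<lambda>t. a t - g t * \<sigma>) ` S)
       \<le> Max ((\<lambda>t. a t + f t * \<sigma>) ` S) + Max ((\<lambda>t. a t - f t * \<sigma>) ` S)"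
proof -
  obtain s where s: "s \<in> S" "Max ((\<lambda>t. a t + g t * \<sigma>) ` S) = a s + g s * \<sigma>"
    using Max_image_attained[OF S] .
  obtain t where t: "t \<in> S" "Max ((\<lambda>t. a t - g t * \<sigma>) ` S) = a t - g t * \<sigma>"
    using Max_image_attained[OF S] .
  have ub: "a u + f u * \<sigma> \<le> Max ((\<lambda>t. a t + f t * \<sigma>) ` S)"
    "a u - f u * \<sigma> \<le> Max ((\<lambda>t. a t - f t * \<sigma>) ` S)" if "u \<in> S" for u
    using S that by auto
  have "(g s - g t) * \<sigma> \<le> \<bar>(f s - f t) * \<sigma>\<bar>"
    using le[OF s(1) t(1)] abs_ge_self[of "(g s - g t) * \<sigma>"] \<sigma> by (simp add: abs_mult)
  then have "g s * \<sigma> - g t * \<sigma> \<le> \<bar>f s * \<sigma> - f t * \<sigma>\<bar>"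
    by (simp add: left_diff_distrib)
  then show ?thesis
    using ub[OF s(1)] ub[OF t(1)] s(2) t(2) by linarith
qed

text \<open>
  The primed data may change both the coefficient and the sign in position \<open>k\<close>, so that this covers
  replacing a coefficient as well as flipping a sign.
\<close>

lemma bernoulli_sum_change_coordinate:
  assumes sm: "summable (\<lambda>i. x i * \<epsilon> i)" and eq: "\<And>i. i \<noteq> k \<Longrightarrow> x' i * \<epsilon>' i = x i * \<epsilon> i"
  shows "bernoulli_sum x' \<epsilon>' = bernoulli_sum x \<epsilon> - x k * \<epsilon> k + x' k * \<epsilon>' k"
proof -
  have "(\<lambda>i. if i = k then x' i * \<epsilon>' i - x i * \<epsilon> i else 0) sums (x' k * \<epsilon>' k - x k * \<epsilon> k)"
    by (rule sums_single)
  from sums_add[OF summable_sums[OF sm] this]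
  have "(\<lambda>i. x i * \<epsilon> i + (if i = k then x' i * \<epsilon>' i - x i * \<epsilon> i else 0))
      sums ((\<Sum>i. x i * \<epsilon> i) + (x' k * \<epsilon>' k - x k * \<epsilon> k))" .
  also have "(\<lambda>i. x i * \<epsilon> i + (if i = k then x' i * \<epsilon>' i - x i * \<epsilon> i else 0)) = (\<lambda>i. x' i * \<epsilon>' i)"
    using eq by auto
  finally show ?thesis
    by (simp add: sums_iff bernoulli_sum_def)
qed

text \<open>
  Averaging over the flip of the sign with index \<open>k\<close> reduces the claim to the pointwise inequality
  \<open>Max_sign_contraction\<close>, in which \<open>a t\<close> collects the terms not involving that sign.
\<close>

lemma expected_max_contract_coordinate:
  assumes S: "finite S" "S \<noteq> {}"
    and z: "\<And>t. t \<in> S \<Longrightarrow> z t \<in> ell2" and y: "\<And>t. t \<in> S \<Longrightarrow> y t \<in> ell2"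
    and eq: "\<And>t i. t \<in> S \<Longrightarrow> i \<noteq> k \<Longrightarrow> y t i = z t i"
    and le: "\<And>s t. s \<in> S \<Longrightarrow> t \<in> S \<Longrightarrow> \<bar>y s k - y t k\<bar> \<le> \<bar>z s k - z t k\<bar>"
  shows "expected_max y S \<le> expected_max z S"
proof -
  let ?M = "\<lambda>z \<epsilon>. Max ((\<lambda>t. bernoulli_sum (z t) \<epsilon>) ` S)"
  have iz: "integrable rademacher (?M z)" and iy: "integrable rademacher (?M y)"
    using S z y by (auto intro!: integrable_Max_bernoulli_sum)
  have flip: "2 * (\<integral>\<epsilon>. f \<epsilon> \<partial>rademacher) = (\<integral>\<epsilon>. f \<epsilon> + f (flip k \<epsilon>) \<partial>rademacher)"
    if "integrable rademacher f" for f :: "(nat \<Rightarrow> real) \<Rightarrow> real"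
    using that integrable_flip[OF that, of k] integral_flip[of f k] by simp
  have "AE \<epsilon> in rademacher. \<forall>t\<in>S. summable (\<lambda>i. z t i * \<epsilon> i)"
    using S z by (simp add: AE_finite_all AE_summable_rademacher)
  with AE_coordinate
  have "AE \<epsilon> in rademacher. ?M y \<epsilon> + ?M y (flip k \<epsilon>) \<le> ?M z \<epsilon> + ?M z (flip k \<epsilon>)"
  proof eventually_elim
    case (elim \<epsilon>)
    define a where "a = (\<lambda>t. bernoulli_sum (z t) \<epsilon> - z t k * \<epsilon> k)"
    have "bernoulli_sum (z t) \<epsilon> = a t + z t k * \<epsilon> k"
      "bernoulli_sum (z t) (flip k \<epsilon>) = a t - z t k * \<epsilon> k"
      "bernoulli_sum (y t) \<epsilon> = a t + y t k * \<epsilon> k"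
      "bernoulli_sum (y t) (flip k \<epsilon>) = a t - y t k * \<epsilon> k" if t: "t \<in> S" for t
    proof -
      have sm: "summable (\<lambda>i. z t i * \<epsilon> i)" using elim t by blast
      show "bernoulli_sum (z t) \<epsilon> = a t + z t k * \<epsilon> k" by (simp add: a_def)
      show "bernoulli_sum (z t) (flip k \<epsilon>) = a t - z t k * \<epsilon> k"
        by (subst bernoulli_sum_change_coordinate[OF sm, of k]) (auto simp: flip_apply a_def)
      show "bernoulli_sum (y t) \<epsilon> = a t + y t k * \<epsilon> k"
        by (subst bernoulli_sum_change_coordinate[OF sm, of k]) (auto simp: eq t a_def)
      show "bernoulli_sum (y t) (flip k \<epsilon>) = a t - y t k * \<epsilon> k"
        by (subst bernoulli_sum_change_coordinate[OF sm, of k]) (auto simp: flip_apply eq t a_def)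
    qed
    then show ?case
      using Max_sign_contraction[OF S, of "\<epsilon> k" "\<lambda>t. y t k" "\<lambda>t. z t k" a] elim le
      by (simp cong: image_cong_simp)
  qed
  then have "(\<integral>\<epsilon>. ?M y \<epsilon> + ?M y (flip k \<epsilon>) \<partial>rademacher) \<le> (\<integral>\<epsilon>. ?M z \<epsilon> + ?M z (flip k \<epsilon>) \<partial>rademacher)"
    using iz iy integrable_flip[OF iz, of k] integrable_flip[OF iy, of k]
    by (intro integral_mono_AE Bochner_Integration.integrable_add) auto
  then show ?thesis
    using flip[OF iz] flip[OF iy] by (simp add: expected_max_def)
qed

text \<open>
  The coordinates are replaced one at a time; the hybrid vectors converge in \<open>\<ell>\<^sup>2\<close> to the new ones,
  which handles the infinitely many coordinates.
\<close>

lemma expected_max_contraction: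
  assumes S: "finite S" "S \<noteq> {}"
    and z: "\<And>t. t \<in> S \<Longrightarrow> z t \<in> ell2" and y: "\<And>t. t \<in> S \<Longrightarrow> y t \<in> ell2"
    and le: "\<And>s t i. s \<in> S \<Longrightarrow> t \<in> S \<Longrightarrow> \<bar>y s i - y t i\<bar> \<le> \<bar>z s i - z t i\<bar>"
  shows "expected_max y S \<le> expected_max z S"
proof -
  define h where "h = (\<lambda>n t i. if i < n then y t i else z t i)"
  have diff: "(\<lambda>i. h n t i - y t i) = (\<lambda>i. if i < n then 0 else z t i - y t i)" for n t
    by (auto simp: h_def)
  have h: "h n t \<in> ell2" if "t \<in> S" for n t
  proof -
    have "(\<lambda>i. h n t i - y t i) \<in> ell2"
      unfolding diff by (rule ell2_dominated[OF ell2_diff[OF z y]]) (use that in auto)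
    \<comment> \<open>The hybrid is the difference \<open>(h n t - y t) - (- y t)\<close> of square summable vectors.\<close>
    moreover have "(\<lambda>i. - y t i) \<in> ell2"
      by (rule ell2_dominated[OF y[OF that]]) simp
    ultimately show ?thesis
      using ell2_diff by fastforce
  qed
  have "expected_max (h n) S \<le> expected_max z S" for n
  proof (induction n)
    case 0
    then show ?case by (simp add: h_def)
  next
    case (Suc n)
    have "expected_max (h (Suc n)) S \<le> expected_max (h n) S"
      by (rule expected_max_contract_coordinate[where k=n]) (use S h le in \<open>auto simp: h_def\<close>)
    with Suc show ?case by simp
  qed
  moreover have "(\<lambda>n. expected_max (h n) S) \<longlonglongrightarrow> expected_max y S"
  proof (rule expected_max_tendsto[OF S h y])
    fix t assume "t \<in> S"
    then have "(\<lambda>n. \<Sum>i. (if i < n then 0 else z t i - y t i)\<^sup>2) \<longlonglongrightarrow> 0"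
      by (intro ell2_tail_tendsto_0 ell2_diff z y)
    then show "(\<lambda>n. \<Sum>i. (h n t i - y t i)\<^sup>2) \<longlonglongrightarrow> 0"
      by (simp add: fun_cong[OF diff])
  qed
  ultimately show ?thesis
    by (intro LIMSEQ_le_const2[where X="\<lambda>n. expected_max (h n) S"]) auto
qed

text \<open>
  Talagrand's contraction principle.  The hypothesis is on differences in each coordinate, because the
  application compares truncations around two different centres.
\<close>

lemma bernoulli_sup_contraction:
  assumes z: "\<And>t. t \<in> D \<Longrightarrow> z t \<in> ell2" and y: "\<And>t. t \<in> D \<Longrightarrow> y t \<in> ell2"
    and le: "\<And>s t i. s \<in> D \<Longrightarrow> t \<in> D \<Longrightarrow> \<bar>y s i - y t i\<bar> \<le> \<bar>z s i - z t i\<bar>"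
  shows "bernoulli_sup y D \<le> bernoulli_sup z D"
  unfolding bernoulli_sup_eq_SUP_expected_max
proof (rule SUP_mono)
  fix S assume S: "S \<in> {S. S \<subseteq> D \<and> finite S \<and> S \<noteq> {}}"
  then have "expected_max y S \<le> expected_max z S"
    using z y le by (intro expected_max_contraction) (auto simp: subset_iff)
  with S show "\<exists>S'\<in>{S. S \<subseteq> D \<and> finite S \<and> S \<noteq> {}}. ereal (expected_max y S) \<le> ereal (expected_max z S')"
    by auto
qed

lemma bernoulli_sup_mono: "D \<subseteq> D' \<Longrightarrow> bernoulli_sup z D \<le> bernoulli_sup z D'"
  unfolding bernoulli_sup_def by (rule SUP_subset_mono) auto

lemma expected_max_le_bernoulli_sup:
  "S \<subseteq> D \<Longrightarrow> finite S \<Longrightarrow> S \<noteq> {} \<Longrightarrow> ereal (expected_max z S) \<le> bernoulli_sup z D"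
  unfolding bernoulli_sup_eq_SUP_expected_max by (rule SUP_upper) simp

lemma bernoulli_sup_nonneg:
  assumes "t \<in> D" "z t \<in> ell2"
  shows "0 \<le> bernoulli_sup z D"
  using expected_max_le_bernoulli_sup[of "{t}" D z] assms
  by (simp add: expected_max_def integral_bernoulli_sum zero_ereal_def)

text \<open>
  A centred maximum of two variables has expectation \<open>E \<bar>X - Y\<bar> / 2\<close>, to which Khintchine's inequality
  applies.
\<close>

lemma dist2_le_bernoulli_sup:
  assumes st: "s \<in> D" "t \<in> D" and z: "z s \<in> ell2" "z t \<in> ell2"
  shows "ereal (dist2 (z s) (z t) / 8) \<le> bernoulli_sup z D"
proof -
  let ?s = "bernoulli_sum (z s)" and ?t = "bernoulli_sum (z t)"
  have "dist2 (z s) (z t) / 4 \<le> (\<integral>\<epsilon>. \<bar>bernoulli_sum (\<lambda>i. z s i - z t i) \<epsilon>\<bar> \<partial>rademacher)"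
    using khintchine[OF ell2_diff[OF z]] by (simp add: dist2_def)
  also have "\<dots> = (\<integral>\<epsilon>. \<bar>?s \<epsilon> - ?t \<epsilon>\<bar> \<partial>rademacher)"
    by (rule integral_cong_AE) (use AE_bernoulli_sum_diff[OF z] in auto)
  also have "\<dots> = (\<integral>\<epsilon>. 2 * max (?s \<epsilon>) (?t \<epsilon>) - ?s \<epsilon> - ?t \<epsilon> \<partial>rademacher)"
    by (rule Bochner_Integration.integral_cong) (auto simp: max_def)
  also have "\<dots> = 2 * (\<integral>\<epsilon>. max (?s \<epsilon>) (?t \<epsilon>) \<partial>rademacher)"
    using z by (simp add: integral_bernoulli_sum)
  also have "(\<integral>\<epsilon>. max (?s \<epsilon>) (?t \<epsilon>) \<partial>rademacher) = expected_max z {s, t}"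
    by (simp add: expected_max_def max.commute)
  finally have "dist2 (z s) (z t) / 8 \<le> expected_max z {s, t}" by simp
  moreover have "ereal (expected_max z {s, t}) \<le> bernoulli_sup z D"
    using st by (intro expected_max_le_bernoulli_sup) auto
  ultimately show ?thesis
    by (meson ereal_less_eq(3) order_trans)
qed

section \<open>Comparison of truncated functionals\<close>

text \<open>
  The shifted interval \<open>[e - \<alpha>, e + \<alpha>]\<close> lies inside \<open>[- \<beta>, \<beta>]\<close>, so the inner clamp factors through the
  outer one, and clamping is a contraction.
\<close>

lemma clamp_contraction:
  fixes p q e \<alpha> \<beta> :: real
  assumes "0 \<le> \<alpha>" "\<alpha> + \<bar>e\<bar> \<le> \<beta>"
  shows "\<bar>max (- \<alpha>) (min (p - e) \<alpha>) - max (- \<alpha>) (min (q - e) \<alpha>)\<bar>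
    \<le> \<bar>max (- \<beta>) (min p \<beta>) - max (- \<beta>) (min q \<beta>)\<bar>"
  using assms by (simp add: max_def min_def abs_if split: if_splits)

lemma trunc_contraction: "\<bar>trunc r j x - trunc r j y\<bar> \<le> \<bar>x - y\<bar>"
  unfolding trunc_def by (simp add: max_def min_def abs_if)

lemma abs_trunc_le:
  assumes "0 < r"
  shows "\<bar>trunc r j x\<bar> \<le> \<bar>x\<bar>"
proof -
  have "0 \<le> r powi (- j)" using assms by simp
  then show ?thesis
    unfolding trunc_def by (simp add: max_def min_def abs_if)
qed

lemma powi_next_level:
  fixes r :: real
  assumes "0 < r"
  shows "r powi (- (i + 1)) = r powi (- i) / r"
  using assms power_int_add[of r "- i" "- 1"] by (simp add: field_simps power_int_minus)

text \<open>
  With \<open>h = r powi (- (j + 1))\<close> the centre moves by at most \<open>r h\<close>, and the new truncation range fits into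
  the old one because \<open>3 h + r h \<le> 3 r h\<close>; this is why truncation happens at three times the scale.
\<close>

lemma trunc_next_level_contraction:
  assumes r: "2 \<le> r" and near: "\<bar>w - u\<bar> \<le> r powi (- j)"
  shows "\<bar>trunc r (j + 1) (x - w) - trunc r (j + 1) (y - w)\<bar> \<le> \<bar>trunc r j (x - u) - trunc r j (y - u)\<bar>"
proof -
  define h where "h = r powi (- (j + 1))"
  have h: "0 \<le> h" "r powi (- j) = r * h"
    using r powi_next_level[of r j] by (simp_all add: h_def)
  have "2 * h \<le> r * h" using r h by (intro mult_right_mono) auto
  then have "3 * h + \<bar>w - u\<bar> \<le> 3 * (r * h)"
    using near h by linarith
  then show ?thesis
    using clamp_contraction[of "3 * h" "w - u" "3 * (r * h)" "x - u" "y - u"] h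
    unfolding trunc_def h(2) h_def[symmetric] by simp
qed

lemma phi_ell2:
  assumes "0 < r" "u \<in> ell2" "t \<in> ell2"
  shows "phi r I u j t \<in> ell2"
  by (rule ell2_dominated[OF ell2_diff[OF assms(3,2)]]) (auto simp: phi_def abs_trunc_le assms)

lemma F_mono: "D \<subseteq> D' \<Longrightarrow> F r I u j D \<le> F r I u j D'"
  unfolding F_def by (rule bernoulli_sup_mono)

lemma F_nonneg:
  assumes "0 < r" "u \<in> ell2" "D \<subseteq> ell2" "D \<noteq> {}"
  shows "0 \<le> F r I u j D"
proof -
  obtain t where "t \<in> D" using assms by blast
  with assms show ?thesis
    unfolding F_def by (intro bernoulli_sup_nonneg[of t] phi_ell2) auto
qed

lemma F_le_b:
  assumes "0 < r" "u \<in> ell2" "D \<subseteq> ell2"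
  shows "F r I u j D \<le> b D"
  unfolding F_def b_def
proof (rule bernoulli_sup_contraction)
  fix s t i
  show "\<bar>phi r I u j s i - phi r I u j t i\<bar> \<le> \<bar>s i - t i\<bar>"
    using trunc_contraction[of r j "s i - u i" "t i - u i"] by (simp add: phi_def)
qed (use assms in \<open>auto intro: phi_ell2\<close>)

text \<open>
  Coordinates outside the new index set vanish identically, and on the others the new centre is
  within \<open>r powi (- j)\<close> of the old one.
\<close>

lemma F_next_level_le:
  assumes "2 \<le> r" "u \<in> ell2" "w \<in> ell2" "D \<subseteq> ell2"
  shows "F r (close_coords r I u j w) w (j + 1) D \<le> F r I u j D"
  unfolding F_def
proof (rule bernoulli_sup_contraction)
  fix s t i
  show "\<bar>phi r (close_coords r I u j w) w (j + 1) s i - phi r (close_coords r I u j w) w (j + 1) t i\<bar>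
      \<le> \<bar>phi r I u j s i - phi r I u j t i\<bar>"
    using trunc_next_level_contraction[OF assms(1), of "w i" "u i" j "s i" "t i"]
    by (auto simp: phi_def close_coords_def)
qed (use assms in \<open>auto intro: phi_ell2\<close>)

lemma diam2_le_b:
  assumes "T \<subseteq> ell2"
  shows "diam2 T \<le> 8 * b T"
  unfolding diam2_def
proof (intro SUP_least)
  fix s t assume "s \<in> T" "t \<in> T"
  then have le: "ereal (dist2 s t / 8) \<le> b T"
    using dist2_le_bernoulli_sup[of s T t "\<lambda>t. t"] assms by (auto simp: b_def)
  have "ereal (dist2 s t) = 8 * ereal (dist2 s t / 8)" by simp
  also have "\<dots> \<le> 8 * b T" using le by (intro ereal_mult_left_mono) auto
  finally show "ereal (dist2 s t) \<le> 8 * b T" .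
qed

section \<open>Sums along a sequence of levels\<close>

text \<open>
  Each gap of length \<open>k\<close> splits into \<open>k\<close> steps, and for each position in the gap the steps
  telescope.  This expresses that intervals of length \<open>k\<close> overlap at most \<open>k\<close> times.
\<close>

lemma telescoping_gap_sum:
  fixes g :: "nat \<Rightarrow> real"
  assumes "decseq g" "\<And>n. 0 \<le> g n"
  shows "(\<Sum>n<M. g n - g (n + k)) \<le> real k * g 0"
proof (induction k)
  case (Suc k)
  have "(\<Sum>n<M. g (n + k) - g (Suc n + k)) = g k - g (M + k)"
    by (induction M) auto
  also have "\<dots> \<le> g 0"
    using assms decseqD[OF assms(1), of 0 k] by (smt (verit) le0)
  finally have "(\<Sum>n<M. g (n + k) - g (n + Suc k)) \<le> g 0" by simp
  moreover have "(\<Sum>n<M. g n - g (n + Suc k))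
      = (\<Sum>n<M. g n - g (n + k)) + (\<Sum>n<M. g (n + k) - g (n + Suc k))"
    by (simp flip: sum.distrib)
  ultimately show ?case
    using Suc by (simp add: algebra_simps)
qed simp

text \<open>
  The properties of the levels \<open>j\<close> and functionals \<open>G\<close> along a branch on which the summation depends.
  Assumption \<open>stay\<close> comes from greedy subdivisions alone; \<open>drop\<close> combines a greedy subdivision at
  step \<open>n\<close> with a second subdivision at step \<open>q\<close>.
\<close>

locale level_sequence =
  fixes j :: "nat \<Rightarrow> int" and G :: "nat \<Rightarrow> real" and r \<eta> :: real and \<kappa> :: nat
  assumes r: "4 \<le> r" "2 * r \<le> 2 ^ \<kappa>" and \<eta>: "0 < \<eta>"
    and step: "j (Suc n) = j n \<or> j (Suc n) = j n + 1"
    and G_nonneg: "0 \<le> G n" and G_dec: "G (Suc n) \<le> G n"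
    and stay: "1 \<le> n \<Longrightarrow> j (n - 1) = j n \<Longrightarrow> \<eta> * (2 ^ n * r powi (- j n)) \<le> G (n - 1)"
    and drop: "1 \<le> n \<Longrightarrow> j (n - 1) = j n \<Longrightarrow> n + 2 \<le> q \<Longrightarrow> q \<le> n + \<kappa> \<Longrightarrow>
      (\<And>m. n + 1 \<le> m \<Longrightarrow> m \<le> q - 1 \<Longrightarrow> j m = j n + 1) \<Longrightarrow> j q = j n + 2 \<Longrightarrow>
      G q + \<eta> * (2 ^ n * r powi (- j n)) \<le> G (n - 1)"
begin

definition a :: "nat \<Rightarrow> real" where
  "a n = 2 ^ n * r powi (- j n)"

definition peak :: "nat \<Rightarrow> bool" where
  "peak n \<longleftrightarrow> 1 \<le> n \<and> j (n - 1) = j n \<and> j (Suc n) = j n + 1"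

text \<open>
  For a peak \<open>n\<close>, the level rises a second time within the window \<open>{n + 2..n + \<kappa>}\<close> in which the
  second rule is available.
\<close>

definition good :: "nat \<Rightarrow> bool" where
  "good n \<longleftrightarrow> (\<exists>q. n + 2 \<le> q \<and> q \<le> n + \<kappa> \<and> j q \<noteq> j n + 1)"

lemma a_pos: "0 < a n"
  using r by (simp add: a_def zero_less_power_int)

lemma a_stay: "j (Suc n) = j n \<Longrightarrow> a (Suc n) = 2 * a n"
  by (simp add: a_def)

lemma r_pos: "0 < r"
  using r by simp

lemma a_jump: "j (Suc n) = j n + 1 \<Longrightarrow> a (Suc n) \<le> a n / 2"
proof -
  assume "j (Suc n) = j n + 1"
  then have "a (Suc n) = a n * (2 / r)"
    using powi_next_level[OF r_pos, of "j n"] by (simp add: a_def)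
  also have "\<dots> \<le> a n * (1 / 2)"
    using r a_pos[of n] by (intro mult_left_mono) (auto simp: field_simps)
  finally show ?thesis by simp
qed

lemma decseq_G: "decseq G"
  by (rule decseq_SucI) (rule G_dec)

lemma a_le_after_stay: "1 \<le> n \<Longrightarrow> j (n - 1) = j n \<Longrightarrow> a n \<le> G 0 / \<eta>"
  using stay[of n] decseqD[OF decseq_G, of 0 "n - 1"] \<eta>
  by (simp add: a_def field_simps)

text \<open>
  Every \<open>n \<ge> 1\<close> is a peak, or is at most half of \<open>a (n + 1)\<close> (the level stays), or at most half of
  \<open>a (n - 1)\<close> (the level has just risen).  An index is charged from both sides only if it is a peak,
  so the total charge is at most half of the whole sum plus half of the peaks, and the whole sum can be absorbed on the left.
  The term \<open>G 0 / \<eta>\<close> pays for the charge to \<open>M + 1\<close>.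
\<close>

lemma sum_le_peaks:
  "(\<Sum>n=1..M. a n) \<le> 3 * (\<Sum>n | n \<in> {1..M} \<and> peak n. a n) + a 0 + G 0 / \<eta>"
proof -
  define f where "f = (\<lambda>m. if j (Suc m) \<noteq> j m then a m else 0)"
  define g where "g = (\<lambda>m. if j m = j (m - 1) then a m else 0)"
  define p where "p = (\<lambda>m. if peak m then a m else 0)"
  have nn: "0 \<le> f m" "0 \<le> g m" "0 \<le> p m" for m
    using a_pos[of m] by (auto simp: f_def g_def p_def)
  have "a n \<le> p n + f (n - 1) / 2 + g (Suc n) / 2" if "n \<in> {1..M}" for n
  proof -
    from that obtain m where n: "n = Suc m" by (cases n) auto
    consider "j (Suc n) = j n" | "j n = j m + 1" | "peak n"
      using step[of n] step[of m] by (auto simp: peak_def n)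
    then show ?thesis
    proof cases
      case 1
      then have "g (Suc n) = 2 * a n" by (simp add: g_def a_stay)
      then show ?thesis using nn[of n] nn[of m] by (simp add: n)
    next
      case 2
      then have "f m = a m" "a n \<le> a m / 2"
        using a_jump[of m] by (auto simp: f_def n)
      then show ?thesis using nn[of n] nn[of "Suc n"] by (simp add: n)
    next
      case 3
      then show ?thesis using nn[of "Suc n"] nn[of m] by (simp add: p_def n)
    qed
  qed
  then have "(\<Sum>n=1..M. a n) \<le> (\<Sum>n=1..M. p n + f (n - 1) / 2 + g (Suc n) / 2)"
    by (rule sum_mono)
  then have 1: "(\<Sum>n=1..M. a n) \<le> (\<Sum>n=1..M. p n) + (\<Sum>n=1..M. f (n - 1)) / 2 + (\<Sum>n=1..M. g (Suc n)) / 2"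
    by (simp add: sum.distrib sum_divide_distrib)
  have 2: "(\<Sum>n=1..M. f (n - 1)) + f M = f 0 + (\<Sum>n=1..M. f n)"
    by (induction M) auto
  have 3: "(\<Sum>n=1..M. g (Suc n)) + g 1 = (\<Sum>n=1..M. g n) + g (Suc M)"
    by (induction M) auto
  have "(\<Sum>n=1..M. f n) + (\<Sum>n=1..M. g n) \<le> (\<Sum>n=1..M. a n + p n)"
    unfolding sum.distrib[symmetric]
  proof (rule sum_mono)
    fix n assume "n \<in> {1..M}"
    then show "f n + g n \<le> a n + p n"
      using step[of n] a_pos[of n] by (auto simp: f_def g_def p_def peak_def)
  qed
  then have 4: "(\<Sum>n=1..M. f n) + (\<Sum>n=1..M. g n) \<le> (\<Sum>n=1..M. a n) + (\<Sum>n=1..M. p n)"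
    by (simp add: sum.distrib)
  have 5: "f 0 \<le> a 0" using a_pos[of 0] by (simp add: f_def)
  have 6: "g (Suc M) \<le> G 0 / \<eta>"
    using a_le_after_stay[of "Suc M"] G_nonneg[of 0] \<eta> by (auto simp: g_def)
  have 7: "(\<Sum>n=1..M. p n) = (\<Sum>n | n \<in> {1..M} \<and> peak n. a n)"
    unfolding p_def by (subst sum.inter_filter[symmetric]) auto
  show ?thesis
    using 1 2 3 4 5 6 nn[of M] nn[of 1] unfolding 7 by linarith
qed

lemma good_peak_drop:
  assumes "peak n" "good n"
  shows "\<eta> * a n \<le> G (n - 1) - G (n + \<kappa>)"
proof -
  define q where "q = (LEAST q. n + 2 \<le> q \<and> q \<le> n + \<kappa> \<and> j q \<noteq> j n + 1)"
  have q: "n + 2 \<le> q" "q \<le> n + \<kappa>" "j q \<noteq> j n + 1"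
    using LeastI_ex[OF assms(2)[unfolded good_def]] unfolding q_def by blast+
  have before: "j m = j n + 1" if "n + 1 \<le> m" "m \<le> q - 1" for m
  proof (cases "m = n + 1")
    case True
    then show ?thesis using assms(1) by (simp add: peak_def)
  next
    case False
    then show ?thesis
      using not_less_Least[of m "\<lambda>q. n + 2 \<le> q \<and> q \<le> n + \<kappa> \<and> j q \<noteq> j n + 1"] that q
      unfolding q_def[symmetric] by auto
  qed
  have "Suc (q - 1) = q" using q by simp
  then have "j q = j n + 2"
    using step[of "q - 1"] before[of "q - 1"] q by auto
  then have "G q + \<eta> * a n \<le> G (n - 1)"
    using drop[of n q] assms(1) q before by (auto simp: peak_def a_def)
  moreover have "G (n + \<kappa>) \<le> G q"
    using decseqD[OF decseq_G] q by blast
  ultimately show ?thesis by linarith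
qed

text \<open>
  The drops are extended to the intervals \<open>[n - 1, n + \<kappa>]\<close>, whose length \<open>\<kappa> + 1\<close> does not depend on \<open>n\<close>,
  and then summed over all \<open>n\<close>.
\<close>

lemma sum_good_peaks:
  "(\<Sum>n | n \<in> {1..M} \<and> peak n \<and> good n. a n) \<le> (\<kappa> + 1) * (G 0 / \<eta>)"
proof -
  let ?M = "{n. n \<in> {1..M} \<and> peak n \<and> good n}"
  have fin: "finite ?M" by (rule finite_subset[of _ "{1..M}"]) auto
  have "\<eta> * (\<Sum>n\<in>?M. a n) = (\<Sum>n\<in>?M. \<eta> * a n)" by (rule sum_distrib_left)
  also have "\<dots> \<le> (\<Sum>n\<in>?M. G (n - 1) - G (n + \<kappa>))"
  proof (rule sum_mono)
    fix n assume "n \<in> ?M"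
    then show "\<eta> * a n \<le> G (n - 1) - G (n + \<kappa>)" by (intro good_peak_drop) auto
  qed
  also have "\<dots> \<le> (\<Sum>n=1..M. G (n - 1) - G (n + \<kappa>))"
    by (rule sum_mono2) (auto intro!: decseqD[OF decseq_G])
  also have "\<dots> = (\<Sum>n<M. G n - G (n + (\<kappa> + 1)))"
    by (rule sum.reindex_bij_witness[where i=Suc and j="\<lambda>n. n - 1"]) auto
  also have "\<dots> \<le> real (\<kappa> + 1) * G 0"
    by (rule telescoping_gap_sum[OF decseq_G G_nonneg])
  finally show ?thesis using \<eta> by (simp add: field_simps)
qed

text \<open>
  After a peak \<open>n\<close> that is not good the level is constant on \<open>{n + 1..next_jump n}\<close>, which makes
  \<open>next_jump n\<close> the following peak.
\<close>

definition next_jump :: "nat \<Rightarrow> nat" where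
  "next_jump n = (LEAST m. n + 2 \<le> m \<and> j (Suc m) \<noteq> j m)"

text \<open>
  Without a further rise \<open>a\<close> would double forever, against the bound \<open>a_le_after_stay\<close>.
\<close>

lemma jump_exists: "\<exists>m. n + 2 \<le> m \<and> j (Suc m) \<noteq> j m"
proof (rule ccontr)
  assume "\<nexists>m. n + 2 \<le> m \<and> j (Suc m) \<noteq> j m"
  then have eq: "j (Suc m) = j m" if "n + 2 \<le> m" for m using that by blast
  have grow: "a (n + 2 + k) = 2 ^ k * a (n + 2)" for k
    by (induction k) (auto simp: a_stay[OF eq])
  obtain k where k: "G 0 / \<eta> / a (n + 2) < 2 ^ k"
    using real_arch_pow[of 2] by auto
  then have "G 0 / \<eta> < 2 ^ k * a (n + 2)"
    using a_pos[of "n + 2"] by (simp only: pos_divide_less_eq)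
  also have "\<dots> \<le> 2 ^ Suc k * a (n + 2)"
    using a_pos[of "n + 2"] by simp
  finally have "G 0 / \<eta> < a (n + 2 + Suc k)"
    by (simp only: grow)
  moreover have "a (n + 2 + Suc k) \<le> G 0 / \<eta>"
    using eq[of "n + 2 + k"] by (intro a_le_after_stay) auto
  ultimately show False by simp
qed

lemma next_jump_least:
  "n + 2 \<le> next_jump n" "j (Suc (next_jump n)) \<noteq> j (next_jump n)"
  "n + 2 \<le> m \<Longrightarrow> j (Suc m) \<noteq> j m \<Longrightarrow> next_jump n \<le> m"
  using LeastI_ex[OF jump_exists[of n]] Least_le[of "\<lambda>m. n + 2 \<le> m \<and> j (Suc m) \<noteq> j m" m]
  unfolding next_jump_def by auto

text \<open>
  The level stays at \<open>j n + 1\<close> up to an index \<open>m \<ge> n + \<kappa>\<close>, and \<open>a (n + \<kappa>) = 2 ^ \<kappa> / r * a n \<ge> 2 * a n\<close>.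
\<close>

lemma bad_peak_next:
  assumes n: "peak n" "\<not> good n"
  shows "peak (next_jump n)" "2 * a n \<le> a (next_jump n)"
proof -
  let ?m = "next_jump n"
  have \<kappa>: "3 \<le> \<kappa>"
  proof (rule ccontr)
    assume "\<not> 3 \<le> \<kappa>"
    then have "(2::real) ^ \<kappa> \<le> 2 ^ 2" by (intro power_increasing) auto
    with r show False by simp
  qed
  have bad: "j q = j n + 1" if "n + 1 \<le> q" "q \<le> n + \<kappa>" for q
  proof (cases "q = n + 1")
    case True
    then show ?thesis using n by (simp add: peak_def)
  next
    case False
    then show ?thesis using n(2) that by (auto simp: good_def)
  qed
  have const: "j m = j n + 1" if "n + 2 \<le> m" "m \<le> ?m" for m
    using that
  proof (induction m rule: dec_induct)
    case base
    then show ?case using bad[of "n + 2"] \<kappa> by simp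
  next
    case (step m)
    then show ?case using next_jump_least(3)[of n m] by fastforce
  qed
  have "n + \<kappa> \<le> ?m"
  proof (rule ccontr)
    assume "\<not> n + \<kappa> \<le> ?m"
    then have "j (Suc ?m) = j ?m"
      using bad[of ?m] bad[of "Suc ?m"] next_jump_least(1)[of n] by simp
    then show False using next_jump_least(2) by simp
  qed
  have jm: "j ?m = j n + 1" using const[of ?m] next_jump_least(1)[of n] by simp
  have "j (?m - 1) = j n + 1"
    using bad[of "n + 1"] const[of "?m - 1"] next_jump_least(1)[of n] \<kappa>
    by (cases "?m = n + 2") auto
  then show "peak ?m"
    using jm next_jump_least(1,2)[of n] step[of ?m] by (auto simp: peak_def)
  have "2 * a n \<le> 2 ^ \<kappa> / r * a n"
    using r a_pos[of n] by (intro mult_right_mono) (auto simp: field_simps)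
  also have "\<dots> = 2 ^ (n + \<kappa>) * r powi (- j ?m)"
    by (simp add: jm powi_next_level[OF r_pos, of "j n"] a_def power_add del: minus_add_distrib)
  also have "\<dots> \<le> 2 ^ ?m * r powi (- j ?m)"
    using \<open>n + \<kappa> \<le> ?m\<close> r by (intro mult_right_mono power_increasing) auto
  finally show "2 * a n \<le> a ?m" by (simp add: a_def)
qed

lemma next_jump_le:
  assumes "peak n" "peak n'" "n < n'"
  shows "next_jump n \<le> n'"
proof (rule next_jump_least(3))
  have "n' \<noteq> n + 1" using assms by (auto simp: peak_def)
  then show "n + 2 \<le> n'" using assms(3) by simp
  show "j (Suc n') \<noteq> j n'" using assms(2) by (simp add: peak_def)
qed

text \<open>
  Charging each bad peak to its successor is injective, and at most one successor lies beyond \<open>M\<close>;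
  that one is bounded by \<open>G 0 / \<eta>\<close>.
\<close>

lemma sum_bad_peaks:
  "2 * (\<Sum>n | n \<in> {1..M} \<and> peak n \<and> \<not> good n. a n)
     \<le> (\<Sum>n | n \<in> {1..M} \<and> peak n. a n) + G 0 / \<eta>"
proof -
  let ?M = "{n. n \<in> {1..M} \<and> peak n \<and> \<not> good n}"
  let ?P = "{n. n \<in> {1..M} \<and> peak n}"
  let ?W = "{m \<in> next_jump ` ?M. M < m}"
  have fin: "finite ?M" "finite ?P" by (rule finite_subset[of _ "{1..M}"]; auto)+
  have order: "next_jump n < next_jump n'" "next_jump n \<le> M" if "n \<in> ?M" "n' \<in> ?M" "n < n'" for n n'
    using next_jump_le[of n n'] next_jump_least(1)[of n'] that by auto
  have inj: "inj_on next_jump ?M"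
    by (rule linorder_inj_onI) (use order in force)+
  have "2 * (\<Sum>n\<in>?M. a n) \<le> (\<Sum>n\<in>?M. a (next_jump n))"
    unfolding sum_distrib_left by (rule sum_mono) (auto intro: bad_peak_next)
  also have "\<dots> = (\<Sum>m\<in>next_jump ` ?M. a m)"
    by (rule sum.reindex[OF inj, unfolded o_def, symmetric])
  also have "\<dots> \<le> (\<Sum>m\<in>?P \<union> ?W. a m)"
  proof (rule sum_mono2)
    show "finite (?P \<union> ?W)" using fin by simp
    show "next_jump ` ?M \<subseteq> ?P \<union> ?W"
    proof
      fix m assume m: "m \<in> next_jump ` ?M"
      then have "peak m" by (auto intro: bad_peak_next)
      moreover from this have "1 \<le> m" by (simp add: peak_def)
      ultimately show "m \<in> ?P \<union> ?W"
        using m by (cases "m \<le> M") simp_all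
    qed
    show "0 \<le> a m" for m by (rule less_imp_le[OF a_pos])
  qed
  also have "\<dots> = (\<Sum>m\<in>?P. a m) + (\<Sum>m\<in>?W. a m)"
  proof (rule sum.union_disjoint)
    show "finite ?W" using fin by simp
    show "?P \<inter> ?W = {}" by fastforce
  qed (rule fin)
  also have "(\<Sum>m\<in>?W. a m) \<le> G 0 / \<eta>"
  proof (cases "?W = {}")
    case True
    then have "(\<Sum>m\<in>?W. a m) = 0" by (simp only: sum.empty)
    moreover have "0 \<le> G 0 / \<eta>" using G_nonneg[of 0] \<eta> by simp
    ultimately show ?thesis by (simp only:)
  next
    case False
    then obtain n where n: "n \<in> ?M" "M < next_jump n" by blast
    have "n' = n" if "n' \<in> ?M" "M < next_jump n'" for n'
    proof (rule ccontr)
      assume "n' \<noteq> n"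
      then consider "n < n'" | "n' < n" by linarith
      then show False
        using order(2)[OF n(1) that(1)] order(2)[OF that(1) n(1)] n(2) that(2) by cases linarith+
    qed
    then have "?W = {next_jump n}" using n by blast
    then have "(\<Sum>m\<in>?W. a m) = a (next_jump n)" by (simp only:) simp
    also have "\<dots> \<le> G 0 / \<eta>"
      using bad_peak_next(1)[of n] n(1) by (intro a_le_after_stay) (simp_all add: peak_def)
    finally show ?thesis .
  qed
  finally show ?thesis by simp
qed

theorem sum_le:
  "(\<Sum>n<M. 2 ^ n * r powi (- j n)) \<le> 2 * r powi (- j 0) + (6 * \<kappa> + 10) * (G 0 / \<eta>)"
proof -
  define B where "B = G 0 / \<eta>"
  let ?P = "\<Sum>n | n \<in> {1..M} \<and> peak n. a n"
  let ?g = "\<Sum>n | n \<in> {1..M} \<and> peak n \<and> good n. a n"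
  let ?b = "\<Sum>n | n \<in> {1..M} \<and> peak n \<and> \<not> good n. a n"
  have "?P = ?g + ?b"
  proof -
    have "{n. n \<in> {1..M} \<and> peak n} = {n. n \<in> {1..M} \<and> peak n \<and> good n} \<union> {n. n \<in> {1..M} \<and> peak n \<and> \<not> good n}"
      by auto
    moreover have "finite {n. n \<in> {1..M} \<and> peak n \<and> good n}" "finite {n. n \<in> {1..M} \<and> peak n \<and> \<not> good n}"
      by (rule finite_subset[of _ "{1..M}"]; auto)+
    ultimately show ?thesis by (simp only:) (rule sum.union_disjoint, auto)
  qed
  then have "?P \<le> (2 * \<kappa> + 3) * B"
    using sum_good_peaks[of M] sum_bad_peaks[of M]
    unfolding B_def[symmetric] by (simp add: algebra_simps)
  then have "(\<Sum>n=1..M. a n) \<le> a 0 + (6 * \<kappa> + 10) * B"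
    using sum_le_peaks[of M] unfolding B_def[symmetric] by (simp add: algebra_simps)
  moreover have "(\<Sum>n<M. a n) \<le> a 0 + (\<Sum>n=1..M. a n)"
  proof -
    have "(\<Sum>n<M. a n) \<le> (\<Sum>n\<in>{0..M}. a n)"
      using a_pos by (intro sum_mono2) (auto intro: less_imp_le)
    then show ?thesis by (simp add: sum.atLeast_Suc_atMost)
  qed
  ultimately show ?thesis by (simp add: a_def B_def)
qed

end

section \<open>One step of the construction\<close>

text \<open>
  What is known about a child that is the remainder of a greedy subdivision, whichever rule produced
  it.
\<close>

definition stays ::
  "real \<Rightarrow> real \<Rightarrow> real \<Rightarrow> nat \<Rightarrow> nat set \<Rightarrow> (nat \<Rightarrow> real) \<Rightarrow> int \<Rightarrow>
   (nat \<Rightarrow> real) set \<Rightarrow> (nat \<Rightarrow> real) set \<Rightarrow> ((nat \<Rightarrow> real) set \<Rightarrow> nat set) \<Rightarrow>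
   ((nat \<Rightarrow> real) set \<Rightarrow> (nat \<Rightarrow> real)) \<Rightarrow> ((nat \<Rightarrow> real) set \<Rightarrow> int) \<Rightarrow> bool" where
  "stays K \<eta>G r q I u j A S Iq \<pi>q jq \<longleftrightarrow> Iq S = I \<and> \<pi>q S = u \<and> jq S = j \<and>
     (\<forall>s\<in>S. \<forall>D. D \<noteq> {} \<and> D \<subseteq> S \<inter> closed_ball (d r I u j) s (inverse K * 2 powr (real q / 2) * r powi (-j)) \<longrightarrow>
        F r I u j D + ereal (\<eta>G * 2 ^ q * r powi (-j)) \<le> F r I u j A)"

definition advances ::
  "real \<Rightarrow> nat set \<Rightarrow> (nat \<Rightarrow> real) \<Rightarrow> int \<Rightarrow>
   (nat \<Rightarrow> real) set \<Rightarrow> (nat \<Rightarrow> real) set \<Rightarrow> ((nat \<Rightarrow> real) set \<Rightarrow> nat set) \<Rightarrow>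
   ((nat \<Rightarrow> real) set \<Rightarrow> (nat \<Rightarrow> real)) \<Rightarrow> ((nat \<Rightarrow> real) set \<Rightarrow> int) \<Rightarrow> bool" where
  "advances r I u j A S Iq \<pi>q jq \<longleftrightarrow>
     jq S = j + 1 \<and> \<pi>q S \<in> A \<and> Iq S = close_coords r I u j (\<pi>q S)"

lemma greedy_subdivision_cases:
  assumes "greedy_subdivision K \<eta>G r q I u j m A L C w R" "t \<in> A"
  obtains (piece) l where "l \<in> {1..L}" "t \<in> C l" "C l \<subseteq> A" "w l \<in> A"
  | (remainder) "t \<in> R" "R \<subseteq> A"
  using assms unfolding greedy_subdivision_def partition_with_remainder_def by blast

lemma first_rule_child:
  assumes rule: "first_rule K \<eta>G r q I u j A \<C> Iq \<pi>q jq" and t: "t \<in> A"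
  obtains S where "S \<in> \<C>" "t \<in> S" "S \<subseteq> A"
    "stays K \<eta>G r q I u j A S Iq \<pi>q jq \<or> advances r I u j A S Iq \<pi>q jq"
proof -
  obtain L C w R where g: "greedy_subdivision K \<eta>G r q I u j (N (q - 1)) A L C w R"
    and \<C>: "\<C> = (C ` {1..L} \<union> {R}) - {{}}"
    and R: "R \<noteq> {} \<longrightarrow> Iq R = I \<and> \<pi>q R = u \<and> jq R = j"
    and C: "\<forall>l\<in>{1..L}. jq (C l) = j + 1 \<and> \<pi>q (C l) = w l \<and> Iq (C l) = close_coords r I u j (w l)"
    using rule unfolding first_rule_def by blast
  from g t show ?thesis
  proof (cases rule: greedy_subdivision_cases)
    case (piece l)
    then show ?thesis using that[of "C l"] C \<C> by (auto simp: advances_def)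
  next
    case remainder
    have "stays K \<eta>G r q I u j A R Iq \<pi>q jq"
      using g R remainder unfolding stays_def greedy_subdivision_def by blast
    then show ?thesis using that[of R] \<C> remainder by auto
  qed
qed

text \<open>
  The two kinds of pieces of a second subdivision of \<open>B\<close>, forgetting everything except what is
  known about the piece \<open>S\<close> itself.
\<close>

definition small_or_drops ::
  "real \<Rightarrow> real \<Rightarrow> real \<Rightarrow> nat \<Rightarrow> nat set \<Rightarrow> (nat \<Rightarrow> real) \<Rightarrow> int \<Rightarrow> nat set \<Rightarrow> (nat \<Rightarrow> real) \<Rightarrow>
   (nat \<Rightarrow> real) set \<Rightarrow> (nat \<Rightarrow> real) set \<Rightarrow> bool" where
  "small_or_drops K \<eta>W r n I u j J v S B \<longleftrightarrow>
     (\<exists>s\<in>B. S \<subseteq> closed_ball (d r I u j) s (inverse K * 2 powr (real n / 2) * r powi (-j))) \<or>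
     F r J v (j + 1) S + ereal (\<eta>W * 2 ^ n * r powi (-j)) \<le> F r I u j B"

lemma second_rule_child:
  assumes rule: "second_rule K \<eta>G \<eta>W r q n I u j J v A \<C> Iq \<pi>q jq" and t: "t \<in> A"
  obtains S where "S \<in> \<C>" "t \<in> S" "S \<subseteq> A"
    "stays K \<eta>G r q J v (j + 1) A S Iq \<pi>q jq \<or>
     advances r J v (j + 1) A S Iq \<pi>q jq \<and> (\<exists>B\<subseteq>A. small_or_drops K \<eta>W r n I u j J v S B)"
proof -
  obtain L C w R P D tp E where g: "greedy_subdivision K \<eta>G r q J v (j + 1) (N (q - 2)) A L C w R"
    and s: "\<forall>l\<in>{1..L}. second_subdivision K \<eta>W r n I u j J v (C l) (P l) (D l) (tp l) (E l)"
    and \<C>: "\<C> = ((\<Union>l\<in>{1..L}. D l ` {1..P l} \<union> {E l}) \<union> {R}) - {{}}"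
    and R: "R \<noteq> {} \<longrightarrow> Iq R = J \<and> \<pi>q R = v \<and> jq R = j + 1"
    and C: "\<forall>l\<in>{1..L}. \<forall>S \<in> (D l ` {1..P l} \<union> {E l}) - {{}}.
           jq S = j + 2 \<and> \<pi>q S = w l \<and> Iq S = close_coords r J v (j + 1) (w l)"
    using rule unfolding second_rule_def by blast
  from g t show ?thesis
  proof (cases rule: greedy_subdivision_cases)
    case (piece l)
    then have sl: "second_subdivision K \<eta>W r n I u j J v (C l) (P l) (D l) (tp l) (E l)"
      using s by blast
    obtain S where S: "S \<in> D l ` {1..P l} \<union> {E l}" "t \<in> S" "S \<subseteq> C l"
      "small_or_drops K \<eta>W r n I u j J v S (C l)"
    proof -
      have "t \<in> (\<Union>p\<in>{1..P l}. D l p) \<union> E l"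
        using sl piece unfolding second_subdivision_def partition_with_remainder_def by blast
      then consider p where "p \<in> {1..P l}" "t \<in> D l p" | "t \<in> E l" by blast
      then show ?thesis
      proof cases
        case (1 p)
        then have "tp l p \<in> C l" "D l p \<subseteq> C l"
          "D l p \<subseteq> closed_ball (d r I u j) (tp l p) (inverse K * 2 powr (real n / 2) * r powi (-j))"
          using sl unfolding second_subdivision_def partition_with_remainder_def by blast+
        then show ?thesis using that[of "D l p"] 1 unfolding small_or_drops_def by blast
      next
        case 2
        then have "E l \<subseteq> C l" "F r J v (j + 1) (E l) + ereal (\<eta>W * 2 ^ n * r powi (-j)) \<le> F r I u j (C l)"
          using sl unfolding second_subdivision_def partition_with_remainder_def by blast+
        then show ?thesis using that[of "E l"] 2 unfolding small_or_drops_def by blast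
      qed
    qed
    have "S \<in> \<C>" using S piece \<C> by blast
    moreover have "advances r J v (j + 1) A S Iq \<pi>q jq"
    proof -
      have "jq S = j + 2 \<and> \<pi>q S = w l \<and> Iq S = close_coords r J v (j + 1) (w l)"
        using C piece S by blast
      then show ?thesis using piece by (simp add: advances_def)
    qed
    ultimately show ?thesis using that[of S] S piece by blast
  next
    case remainder
    have "stays K \<eta>G r q J v (j + 1) A R Iq \<pi>q jq"
      using g R remainder unfolding stays_def greedy_subdivision_def by blast
    then show ?thesis using that[of R] \<C> remainder by blast
  qed
qed

lemma member_containing_eq:
  assumes "partition_on T P" "A \<in> P" "S \<subseteq> A" "S \<noteq> {}"
  shows "member_containing P S = A"
  unfolding member_containing_def
proof (rule the_equality)
  fix A' assume A': "A' \<in> P \<and> S \<subseteq> A'"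
  then have "A \<inter> A' \<noteq> {}" using assms by blast
  then show "A' = A"
    using assms A' unfolding partition_on_def disjoint_def by blast
qed (use assms in simp)

section \<open>Functionals along a branch of the partitions\<close>

locale construction_branch =
  fixes K \<eta>G \<eta>W r :: real and \<kappa> :: nat and T :: "(nat \<Rightarrow> real) set"
    and \<A> :: "nat \<Rightarrow> (nat \<Rightarrow> real) set set"
    and I :: "nat \<Rightarrow> (nat \<Rightarrow> real) set \<Rightarrow> nat set"
    and \<pi> :: "nat \<Rightarrow> (nat \<Rightarrow> real) set \<Rightarrow> nat \<Rightarrow> real"
    and j :: "nat \<Rightarrow> (nat \<Rightarrow> real) set \<Rightarrow> int"
    and t :: "nat \<Rightarrow> real"
  assumes K: "1 \<le> K" and \<eta>G: "0 < \<eta>G" and \<eta>W: "0 < \<eta>W"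
    and r: "4 \<le> r" "2 * r \<le> 2 ^ \<kappa>"
    and T: "T \<subseteq> ell2" "(\<lambda>_. 0) \<in> T" "b T < \<infinity>"
    and construction: "partition_construction K \<eta>G \<eta>W r \<kappa> T \<A> I \<pi> j"
    and t: "t \<in> T"
begin

definition branch :: "nat \<Rightarrow> (nat \<Rightarrow> real) set" where
  "branch n = member_containing (\<A> n) {t}"

abbreviation coords :: "nat \<Rightarrow> nat set" where "coords n \<equiv> I n (branch n)"
abbreviation center :: "nat \<Rightarrow> nat \<Rightarrow> real" where "center n \<equiv> \<pi> n (branch n)"
abbreviation level :: "nat \<Rightarrow> int" where "level n \<equiv> j n (branch n)"

text \<open>
  The set and the step providing the data vary separately, because the decrease at step \<open>n\<close> compares a
  later set of the branch with an earlier one in the data of step \<open>n\<close>.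
\<close>

definition size_at :: "nat \<Rightarrow> (nat \<Rightarrow> real) set \<Rightarrow> ereal" where
  "size_at n D = F r (coords n) (center n) (level n) D"

lemma partition: "partition_on T (\<A> n)"
  using construction by (simp add: partition_construction_def)

lemma branch_in: "branch n \<in> \<A> n" "t \<in> branch n"
proof -
  obtain A where "A \<in> \<A> n" "t \<in> A"
    using partition[of n] t by (auto simp: partition_on_def)
  then show "branch n \<in> \<A> n" "t \<in> branch n"
    using member_containing_eq[OF partition, of A n "{t}"] by (simp_all add: branch_def)
qed

lemma branch_unique: "A \<in> \<A> n \<Longrightarrow> t \<in> A \<Longrightarrow> A = branch n"
  using member_containing_eq[OF partition, of A n "{t}"] by (simp add: branch_def)

lemma branch_subset: "branch n \<subseteq> T"
  using branch_in(1)[of n] partition[of n] by (auto simp: partition_on_def)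

lemma initial:
  "branch 0 = T" "center 0 = (\<lambda>_. 0)" "ereal (r powi (- level 0)) \<le> diam2 T"
proof -
  obtain j0 where j0: "ereal (r powi (- j0)) \<le> diam2 T" "\<A> 0 = {T}" "j 0 T = j0" "\<pi> 0 T = (\<lambda>_. 0)"
    using construction by (auto simp: partition_construction_def)
  then show "branch 0 = T" using branch_in[of 0] by simp
  with j0 show "center 0 = (\<lambda>_. 0)" "ereal (r powi (- level 0)) \<le> diam2 T" by simp_all
qed

text \<open>
  The construction looks up the data of the ancestors of \<open>branch q\<close> through \<open>member_containing\<close>.  That this
  recovers the branch relies on \<open>branch q \<subseteq> branch m\<close>, which in turn follows from the present lemma at
  earlier steps; so it is an assumption here and is proved by induction in \<open>ancestry\<close>.
\<close>

lemma child_given_ancestry: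
  assumes anc: "\<And>m. m \<le> q \<Longrightarrow> member_containing (\<A> m) (branch q) = branch m"
  shows "branch (Suc q) \<subseteq> branch q"
    and "stays K \<eta>G r (Suc q) (coords q) (center q) (level q) (branch q) (branch (Suc q)) (I (Suc q)) (\<pi> (Suc q)) (j (Suc q))
       \<or> advances r (coords q) (center q) (level q) (branch q) (branch (Suc q)) (I (Suc q)) (\<pi> (Suc q)) (j (Suc q))"
    and "star \<kappa> level (Suc q) n \<Longrightarrow> level (Suc q) = level q + 1 \<Longrightarrow>
       \<exists>B\<subseteq>branch q. small_or_drops K \<eta>W r n (coords n) (center n) (level n) (coords q) (center q) (branch (Suc q)) B"
proof -
  define jm where "jm = (\<lambda>m. j m (member_containing (\<A> m) (branch q)))"
  define \<C> where "\<C> = {S \<in> \<A> (Suc q). S \<subseteq> branch q}"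
  have eq: "jm m = level m" if "m \<le> q" for m
    using anc[OF that] by (simp add: jm_def)
  have star: "star \<kappa> jm (Suc q) n \<longleftrightarrow> star \<kappa> level (Suc q) n" for n
  proof (cases "n + 2 \<le> Suc q")
    case True
    then have "jm (n - 1) = level (n - 1)" and n: "jm n = level n" by (simp_all add: eq)
    moreover have "(\<forall>m\<in>{n + 1..Suc q - 1}. jm m = jm n + 1) \<longleftrightarrow>
        (\<forall>m\<in>{n + 1..Suc q - 1}. level m = level n + 1)"
      by (rule ball_cong) (simp_all add: eq n)
    ultimately show ?thesis unfolding star_def by (simp only:)
  qed (simp add: star_def)
  have "branch q \<in> \<A> (Suc q - 1)" using branch_in(1)[of q] by simp
  note rules = construction[unfolded partition_construction_def, THEN conjunct2, THEN conjunct2,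
      THEN spec[of _ "Suc q"], THEN mp, THEN bspec, OF _ this,
      unfolded Let_def diff_Suc_1 anc[OF order_refl], folded jm_def \<C>_def]
  have first: "first_rule K \<eta>G r (Suc q) (coords q) (center q) (level q) (branch q) \<C> (I (Suc q)) (\<pi> (Suc q)) (j (Suc q))"
    if "\<nexists>n. star \<kappa> level (Suc q) n"
    using rules[THEN conjunct1, unfolded star] that by simp
  have second: "second_rule K \<eta>G \<eta>W r (Suc q) n (coords n) (center n) (level n) (coords q) (center q)
        (branch q) \<C> (I (Suc q)) (\<pi> (Suc q)) (j (Suc q))" if n: "star \<kappa> level (Suc q) n" for n
  proof -
    have "n \<le> q" using n by (simp add: star_def)
    then show ?thesis
      using rules[THEN conjunct2, THEN spec, THEN mp, unfolded star, OF _ n] by (simp add: anc)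
  qed
  have child: "S = branch (Suc q)" if "S \<in> \<C>" "t \<in> S" for S
    using branch_unique that by (auto simp: \<C>_def)
  let ?stays = "stays K \<eta>G r (Suc q) (coords q) (center q) (level q) (branch q) (branch (Suc q)) (I (Suc q)) (\<pi> (Suc q)) (j (Suc q))"
  let ?advances = "advances r (coords q) (center q) (level q) (branch q) (branch (Suc q)) (I (Suc q)) (\<pi> (Suc q)) (j (Suc q))"
  have second': "branch (Suc q) \<subseteq> branch q \<and> (?stays \<or> ?advances \<and>
      (\<exists>B\<subseteq>branch q. small_or_drops K \<eta>W r n (coords n) (center n) (level n) (coords q) (center q) (branch (Suc q)) B))"
    if n: "star \<kappa> level (Suc q) n" for n
  proof -
    have lev: "level q = level n + 1" using n by (auto simp: star_def)
    obtain S where S: "S \<in> \<C>" "t \<in> S" "S \<subseteq> branch q"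
      "stays K \<eta>G r (Suc q) (coords q) (center q) (level q) (branch q) S (I (Suc q)) (\<pi> (Suc q)) (j (Suc q)) \<or>
       advances r (coords q) (center q) (level q) (branch q) S (I (Suc q)) (\<pi> (Suc q)) (j (Suc q)) \<and>
       (\<exists>B\<subseteq>branch q. small_or_drops K \<eta>W r n (coords n) (center n) (level n) (coords q) (center q) S B)"
      using second_rule_child[OF second[OF n] branch_in(2)[of q]] unfolding lev by blast
    show ?thesis
      using S(3,4) unfolding child[OF S(1,2)] by blast
  qed
  have first': "branch (Suc q) \<subseteq> branch q \<and> (?stays \<or> ?advances)" if none: "\<nexists>n. star \<kappa> level (Suc q) n"
  proof -
    obtain S where S: "S \<in> \<C>" "t \<in> S" "S \<subseteq> branch q"
      "stays K \<eta>G r (Suc q) (coords q) (center q) (level q) (branch q) S (I (Suc q)) (\<pi> (Suc q)) (j (Suc q)) \<or>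
       advances r (coords q) (center q) (level q) (branch q) S (I (Suc q)) (\<pi> (Suc q)) (j (Suc q))"
      using first_rule_child[OF first[OF none] branch_in(2)[of q]] by blast
    show ?thesis
      using S(3,4) unfolding child[OF S(1,2)] by blast
  qed
  show "branch (Suc q) \<subseteq> branch q" and "?stays \<or> ?advances"
    using first' second' by blast+
  show "\<exists>B\<subseteq>branch q. small_or_drops K \<eta>W r n (coords n) (center n) (level n) (coords q) (center q) (branch (Suc q)) B"
    if "star \<kappa> level (Suc q) n" "level (Suc q) = level q + 1"
  proof -
    have "\<not> ?stays" using that(2) by (simp add: stays_def)
    then show ?thesis using second'[OF that(1)] by blast
  qed
qed

lemma ancestry: "m \<le> q \<Longrightarrow> branch q \<subseteq> branch m \<and> member_containing (\<A> m) (branch q) = branch m"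
proof (induction q arbitrary: m)
  case 0
  then show ?case
    using member_containing_eq[OF partition branch_in(1)[of 0], of "branch 0"] branch_in(2)[of 0] by auto
next
  case (Suc q)
  have "branch (Suc q) \<subseteq> branch q"
    by (rule child_given_ancestry(1)) (use Suc.IH in blast)
  then have sub: "branch (Suc q) \<subseteq> branch m"
    using Suc by (cases "m = Suc q") (auto simp: le_Suc_eq)
  moreover have "member_containing (\<A> m) (branch (Suc q)) = branch m"
    by (rule member_containing_eq[OF partition branch_in(1) sub]) (use branch_in(2) in blast)
  ultimately show ?case by blast
qed

lemma branch_mono: "m \<le> q \<Longrightarrow> branch q \<subseteq> branch m"
  using ancestry by blast

lemmas child = child_given_ancestry[OF conjunct2[OF ancestry]]

lemma level_step: "level (Suc q) = level q \<or> level (Suc q) = level q + 1"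
  using child(2)[of q] by (auto simp: stays_def advances_def)

lemma center_in: "center q \<in> T"
proof (induction q)
  case 0
  then show ?case using initial T by simp
next
  case (Suc q)
  then show ?case
    using child(2)[of q] branch_subset[of q] by (auto simp: stays_def advances_def)
qed

lemma center_ell2: "center q \<in> ell2"
  using center_in T by blast

lemma size_at_Suc_le:
  assumes "D \<subseteq> T"
  shows "size_at (Suc q) D \<le> size_at q D"
  using child(2)[of q]
proof
  assume "stays K \<eta>G r (Suc q) (coords q) (center q) (level q) (branch q) (branch (Suc q)) (I (Suc q)) (\<pi> (Suc q)) (j (Suc q))"
  then show ?thesis by (simp add: stays_def size_at_def)
next
  assume "advances r (coords q) (center q) (level q) (branch q) (branch (Suc q)) (I (Suc q)) (\<pi> (Suc q)) (j (Suc q))"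
  then have eq: "level (Suc q) = level q + 1"
    "coords (Suc q) = close_coords r (coords q) (center q) (level q) (center (Suc q))"
    by (simp_all add: advances_def)
  have "F r (close_coords r (coords q) (center q) (level q) (center (Suc q))) (center (Suc q)) (level q + 1) D
      \<le> F r (coords q) (center q) (level q) D"
    using r assms T by (intro F_next_level_le center_ell2) auto
  then show ?thesis by (simp add: size_at_def eq)
qed

lemma size_at_antimono:
  assumes "m \<le> q" "D \<subseteq> T"
  shows "size_at q D \<le> size_at m D"
  using assms(1)
proof (induction q rule: dec_induct)
  case (step q)
  then show ?case using size_at_Suc_le[OF assms(2), of q] by simp
qed simp

lemma size_at_mono: "D \<subseteq> D' \<Longrightarrow> size_at q D \<le> size_at q D'"
  unfolding size_at_def by (rule F_mono)

lemma size_at_bounds: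
  assumes "D \<subseteq> T" "D \<noteq> {}"
  shows "0 \<le> size_at q D" "size_at q D \<le> b T" "\<bar>size_at q D\<bar> \<noteq> \<infinity>"
proof -
  show nn: "0 \<le> size_at q D"
    unfolding size_at_def using r assms T by (intro F_nonneg center_ell2) auto
  have "size_at q D \<le> size_at q T" by (rule size_at_mono[OF assms(1)])
  also have "\<dots> \<le> b T"
    unfolding size_at_def using r T by (intro F_le_b center_ell2) auto
  finally show le: "size_at q D \<le> b T" .
  show "\<bar>size_at q D\<bar> \<noteq> \<infinity>"
    using nn le T(3) by auto
qed

definition G :: "nat \<Rightarrow> real" where
  "G n = real_of_ereal (size_at n (branch n))"

lemma branch_nonempty: "branch n \<noteq> {}"
  using branch_in(2) by blast

lemma ereal_G: "ereal (G n) = size_at n (branch n)"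
  unfolding G_def using size_at_bounds(3)[OF branch_subset branch_nonempty] by (simp add: ereal_real')

text \<open>
  If the level stays, then \<open>branch (Suc q)\<close> is the remainder of a greedy subdivision, under either
  rule.
\<close>

lemma greedy_drop:
  assumes same: "level q = level (Suc q)" and s: "s \<in> branch (Suc q)"
    and D: "D \<noteq> {}" "D \<subseteq> branch (Suc q)"
      "D \<subseteq> closed_ball (d r (coords (Suc q)) (center (Suc q)) (level (Suc q))) s
         (inverse K * 2 powr (real (Suc q) / 2) * r powi (- level (Suc q)))"
  shows "size_at (Suc q) D + ereal (\<eta>G * (2 ^ Suc q * r powi (- level (Suc q)))) \<le> ereal (G q)"
proof -
  have st: "stays K \<eta>G r (Suc q) (coords q) (center q) (level q) (branch q) (branch (Suc q)) (I (Suc q)) (\<pi> (Suc q)) (j (Suc q))"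
    using child(2)[of q] same by (auto simp: advances_def)
  then have eq: "coords (Suc q) = coords q" "center (Suc q) = center q" by (simp_all add: stays_def)
  have "D \<noteq> {} \<and> D \<subseteq> branch (Suc q) \<inter> closed_ball (d r (coords q) (center q) (level q)) s
         (inverse K * 2 powr (real (Suc q) / 2) * r powi (- level q))"
    using D by (simp only: eq same) blast
  then have "F r (coords q) (center q) (level q) D + ereal (\<eta>G * 2 ^ Suc q * r powi (- level q))
      \<le> F r (coords q) (center q) (level q) (branch q)"
    using st s unfolding stays_def by blast
  then show ?thesis
    by (simp only: ereal_G size_at_def eq same mult.assoc)
qed

text \<open>
  At a peak \<open>n\<close> with second rise at \<open>q\<close>, a piece in a small ball gives the drop through the greedy
  subdivision at step \<open>n\<close>, and the remaining piece gives it through the second subdivision at step \<open>q\<close>; the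
  constant \<open>min \<eta>G \<eta>W\<close> serves both.
\<close>

lemma branch_level_sequence: "level_sequence level G r (min \<eta>G \<eta>W) \<kappa>"
proof
  show "4 \<le> r" "2 * r \<le> 2 ^ \<kappa>" by (rule r)+
  show "0 < min \<eta>G \<eta>W" using \<eta>G \<eta>W by simp
  fix n
  show "level (Suc n) = level n \<or> level (Suc n) = level n + 1" by (rule level_step)
  show "0 \<le> G n"
    unfolding G_def using size_at_bounds(1)[OF branch_subset branch_nonempty] by (simp add: real_of_ereal_pos)
  have "size_at (Suc n) (branch (Suc n)) \<le> size_at n (branch n)"
    using size_at_Suc_le[OF branch_subset] size_at_mono[OF child(1)] by (rule order_trans)
  then show "G (Suc n) \<le> G n" by (simp flip: ereal_G)
next
  have le_G: "min \<eta>G \<eta>W * (2 ^ n * r powi (- level n)) \<le> \<eta>G * (2 ^ n * r powi (- level n))"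
    "min \<eta>G \<eta>W * (2 ^ n * r powi (- level n)) \<le> \<eta>W * (2 ^ n * r powi (- level n))" for n
    using r by (auto intro!: mult_right_mono)
  have ball0: "0 \<le> inverse K * 2 powr (real n / 2) * r powi (- i)" for n i
    using K r by auto
  {
    fix n assume "1 \<le> n" and same: "level (n - 1) = level n"
    then obtain p where p: "n = Suc p" by (cases n) auto
    \<comment> \<open>The greedy subdivision is applied to \<open>{t}\<close>, whose functional is nonnegative.\<close>
    have "size_at (Suc p) {t} + ereal (\<eta>G * (2 ^ Suc p * r powi (- level (Suc p)))) \<le> ereal (G p)"
    proof (rule greedy_drop)
      show "level p = level (Suc p)" using same p by simp
      show "t \<in> branch (Suc p)" by (rule branch_in)
      have "d r I u i t t = 0" for I u i by (simp add: d_def dist2_def)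
      then show "{t} \<subseteq> closed_ball (d r (coords (Suc p)) (center (Suc p)) (level (Suc p))) t
         (inverse K * 2 powr (real (Suc p) / 2) * r powi (- level (Suc p)))"
        using ball0[of "Suc p"] by (simp add: closed_ball_def)
    qed (use branch_in in auto)
    moreover have "0 \<le> size_at (Suc p) {t}" using t by (intro size_at_bounds) auto
    ultimately have "ereal (\<eta>G * (2 ^ Suc p * r powi (- level (Suc p)))) \<le> ereal (G p)"
      by (metis add_0 add_right_mono order_trans)
    then have "\<eta>G * (2 ^ n * r powi (- level n)) \<le> G (n - 1)"
      using p by simp
    with le_G(1)[of n] show "min \<eta>G \<eta>W * (2 ^ n * r powi (- level n)) \<le> G (n - 1)"
      by (rule order_trans)
  }
  {
    fix n q
    assume n: "1 \<le> n" and same: "level (n - 1) = level n" and q: "n + 2 \<le> q" "q \<le> n + \<kappa>"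
      and mid: "\<And>m. n + 1 \<le> m \<Longrightarrow> m \<le> q - 1 \<Longrightarrow> level m = level n + 1" and last: "level q = level n + 2"
    obtain p where p: "n = Suc p" using n by (cases n) auto
    obtain q' where q': "q = Suc q'" using q by (cases q) auto
    have lev: "level q' = level n + 1" using mid[of q'] q q' by simp
    have "star \<kappa> level (Suc q') n"
      using n same q mid unfolding star_def q' by auto
    then obtain B where B: "B \<subseteq> branch q'"
      "small_or_drops K \<eta>W r n (coords n) (center n) (level n) (coords q') (center q') (branch q) B"
      using child(3)[of q' n] lev last q' by auto
    have sub: "branch q' \<subseteq> branch n" "branch q \<subseteq> branch n"
      using q q' by (auto intro!: branch_mono)
    from B(2) have "\<exists>\<eta>\<in>{\<eta>G, \<eta>W}. ereal (G q) + ereal (\<eta> * (2 ^ n * r powi (- level n))) \<le> ereal (G (n - 1))"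
      unfolding small_or_drops_def
    proof
      assume "\<exists>s\<in>B. branch q \<subseteq> closed_ball (d r (coords n) (center n) (level n)) s
        (inverse K * 2 powr (real n / 2) * r powi (- level n))"
      then obtain s where s: "s \<in> branch (Suc p)"
        "branch q \<subseteq> closed_ball (d r (coords (Suc p)) (center (Suc p)) (level (Suc p))) s
          (inverse K * 2 powr (real (Suc p) / 2) * r powi (- level (Suc p)))"
        using B(1) sub p by blast
      have "size_at n (branch q) + ereal (\<eta>G * (2 ^ n * r powi (- level n))) \<le> ereal (G (n - 1))"
        using greedy_drop[OF _ s(1) branch_nonempty _ s(2)] same sub p by simp
      moreover have "ereal (G q) \<le> size_at n (branch q)"
        unfolding ereal_G using q by (intro size_at_antimono branch_subset) auto
      ultimately show ?thesis
        by (meson add_right_mono insertI1 order_trans)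
    next
      assume "F r (coords q') (center q') (level n + 1) (branch q) + ereal (\<eta>W * 2 ^ n * r powi (- level n))
          \<le> F r (coords n) (center n) (level n) B"
      then have "size_at q' (branch q) + ereal (\<eta>W * (2 ^ n * r powi (- level n))) \<le> size_at n B"
        by (simp only: size_at_def lev mult.assoc)
      also have "\<dots> \<le> size_at n (branch n)"
        using B(1) sub by (intro size_at_mono) auto
      also have "\<dots> \<le> size_at (n - 1) (branch n)"
        by (intro size_at_antimono branch_subset) auto
      also have "\<dots> \<le> ereal (G (n - 1))"
        unfolding ereal_G by (intro size_at_mono branch_mono) auto
      finally have "size_at q' (branch q) + ereal (\<eta>W * (2 ^ n * r powi (- level n))) \<le> ereal (G (n - 1))" .
      moreover have "ereal (G q) \<le> size_at q' (branch q)"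
        unfolding ereal_G using q' by (intro size_at_antimono branch_subset) auto
      ultimately show ?thesis
        by (meson add_right_mono insertI1 insertI2 order_trans)
    qed
    then have "G q + \<eta>G * (2 ^ n * r powi (- level n)) \<le> G (n - 1) \<or>
        G q + \<eta>W * (2 ^ n * r powi (- level n)) \<le> G (n - 1)"
      by auto
    then show "G q + min \<eta>G \<eta>W * (2 ^ n * r powi (- level n)) \<le> G (n - 1)"
      using le_G[of n] by linarith
  }
qed

theorem branch_sum_le:
  "(\<Sum>n. ereal (2 ^ n * r powi (- level n))) \<le> ereal (16 + (6 * \<kappa> + 10) / min \<eta>G \<eta>W) * b T"
proof -
  interpret level_sequence level G r "min \<eta>G \<eta>W" \<kappa> by (rule branch_level_sequence)
  have "0 \<le> b T"
    using size_at_bounds(1,2)[of T 0] T by fastforce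
  then obtain \<beta> where \<beta>: "b T = ereal \<beta>" "0 \<le> \<beta>"
    using T(3) by (cases "b T") auto
  have start: "r powi (- level 0) \<le> 8 * \<beta>"
    using order_trans[OF initial(3) diam2_le_b[OF T(1)]] by (simp add: \<beta>)
  have "ereal (G 0) \<le> b T"
    unfolding ereal_G using branch_subset branch_nonempty by (rule size_at_bounds)
  then have G0: "G 0 / min \<eta>G \<eta>W \<le> \<beta> / min \<eta>G \<eta>W"
    using \<beta> \<eta>G \<eta>W by (simp add: divide_right_mono)
  have "(\<Sum>n<M. ereal (2 ^ n * r powi (- level n))) \<le> ereal (16 + (6 * \<kappa> + 10) / min \<eta>G \<eta>W) * b T" for M
  proof -
    have "(\<Sum>n<M. 2 ^ n * r powi (- level n)) \<le> 2 * r powi (- level 0) + (6 * \<kappa> + 10) * (G 0 / min \<eta>G \<eta>W)"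
      by (rule sum_le)
    also have "\<dots> \<le> 2 * (8 * \<beta>) + (6 * \<kappa> + 10) * (\<beta> / min \<eta>G \<eta>W)"
      using start G0 by (intro add_mono mult_left_mono) auto
    also have "\<dots> = (16 + (6 * \<kappa> + 10) / min \<eta>G \<eta>W) * \<beta>"
      by (simp add: algebra_simps add_divide_distrib)
    finally show ?thesis by (simp add: \<beta>)
  qed
  then show ?thesis
    using r by (intro suminf_bound) (auto simp: zero_ereal_def[symmetric] intro!: mult_nonneg_nonneg)
qed

end

section \<open>Bound for the chaining sum\<close>

theorem proposition6p3:
  fixes K \<eta>\<^sub>G c Cm r \<eta>\<^sub>W :: real and l \<kappa> :: nat
  assumes "greedy_constants K \<eta>\<^sub>G"
    and "minoration_constants c Cm"
    and "l \<ge> 1" and "r = 2 ^ (2 * l)" and "\<kappa> = 3 * l"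
    and "2 * Cm * sqrt (ln 2) * r powr (- 1 / 4) \<le> c / (24 * K\<^sup>2)"
    and "\<eta>\<^sub>W = c / (24 * K\<^sup>2)"
    and "second_constants K \<eta>\<^sub>W r \<kappa>"
  shows "\<exists>C::real. C > 0 \<and>
    (\<forall>T \<A> I \<pi> j.
       T \<subseteq> ell2 \<and> countable T \<and> (\<lambda>_. 0) \<in> T \<and> 0 < b T \<and> b T < \<infinity> \<and>
       partition_construction K \<eta>\<^sub>G \<eta>\<^sub>W r \<kappa> T \<A> I \<pi> j \<longrightarrow>
       (SUP t\<in>T. \<Sum>n. ereal (2 ^ n * r powi (- j n (member_containing (\<A> n) {t}))))
         \<le> ereal C * b T)"
proof -
  have K: "1 \<le> K" and \<eta>G: "0 < \<eta>\<^sub>G"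
    using assms(1) by (auto simp: greedy_constants_def)
  have "0 < c" using assms(2) by (auto simp: minoration_constants_def)
  then have \<eta>W: "0 < \<eta>\<^sub>W" using K assms(7) by simp
  have r4: "r = 4 ^ l" using assms(4) by (simp add: power_mult)
  have "(4::real) ^ 1 \<le> 4 ^ l" using assms(3) by (intro power_increasing) auto
  then have r: "4 \<le> r" by (simp add: r4)
  \<comment> \<open>\<open>2 ^ \<kappa> = 2 ^ l * r\<close>, since \<open>\<kappa> = 3 * l\<close> and \<open>r = 2 ^ (2 * l)\<close>.\<close>
  have "2 * r \<le> 2 ^ l * r"
    using r power_increasing[of 1 l "2::real"] assms(3) by (intro mult_right_mono) auto
  also have "\<dots> = 2 ^ \<kappa>"
    by (simp add: assms(4,5) flip: power_add)
  finally have \<kappa>: "2 * r \<le> 2 ^ \<kappa>" .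
  define C where "C = 16 + (6 * \<kappa> + 10) / min \<eta>\<^sub>G \<eta>\<^sub>W"
  have "0 < C" using \<eta>G \<eta>W by (simp add: C_def add_pos_nonneg)
  moreover have "(SUP t\<in>T. \<Sum>n. ereal (2 ^ n * r powi (- j n (member_containing (\<A> n) {t})))) \<le> ereal C * b T"
    if T: "T \<subseteq> ell2" "(\<lambda>_. 0) \<in> T" "b T < \<infinity>"
      "partition_construction K \<eta>\<^sub>G \<eta>\<^sub>W r \<kappa> T \<A> I \<pi> j" for T \<A> I \<pi> j
  proof (rule SUP_least)
    fix t assume "t \<in> T"
    then interpret construction_branch K \<eta>\<^sub>G \<eta>\<^sub>W r \<kappa> T \<A> I \<pi> j t
      using K \<eta>G \<eta>W r \<kappa> T by unfold_locales
    show "(\<Sum>n. ereal (2 ^ n * r powi (- j n (member_containing (\<A> n) {t})))) \<le> ereal C * b T"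
      using branch_sum_le unfolding branch_def C_def .
  qed
  ultimately show ?thesis by blast
qed

end
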